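(* Let $K$ be any field, $\mathbf R=\operatorname{Lie}(v_0,v_1)$ and $\mathbf A=\operatorname{Alg}(v_0,v_1)$, and consider the triangular decompositions into direct sums of three subalgebras $\mathbf A=\mathbf A_+\oplus\mathbf A_0\oplus\mathbf A_-$ and $\mathbf R=\mathbf R_+\oplus\mathbf R_0\oplus\mathbf R_-$, where the components are spanned by monomials of positive, zero and negative superweight, respectively. Then: (i) the components $\mathbf A_+$ and $\mathbf A_-$ are locally nilpotent; (ii) all three components $\mathbf R_+,\mathbf R_0,\mathbf R_-$ are locally nilpotent.
   Context: Let $\Lambda=\Lambda(x_i\mid i\ge 0)$ be the Grassmann (exterior) algebra over $K$ on odd generators $x_0,x_1,\dots$, a $\mathbb Z_2$-graded algebra. In $\operatorname{End}\Lambda$ identify $x_i$ with left multiplication by $x_i$, and let $\partial_i$ be the odd superderivation of $\Lambda$ with $\partial_i(x_j)=\delta_{ij}$. The supercommutator is $[a,b]=ab-(-1)^{\deg a\deg b}ba$. The pivot elements are the odd superderivations $v_i=\partial_i+x_ix_{i+1}(\partial_{i+2}+x_{i+2}x_{i+3}(\partial_{i+4}+\cdots))$, $i\ge 0$, that is, $v_i=\partial_i+x_ix_{i+1}v_{i+2}$ (well defined on $\Lambda$, since each element involves finitely many letters). $\mathbf R=\operatorname{Lie}(v_0,v_1)$ is the smallest $\mathbb Z_2$-graded subspace of $\operatorname{End}\Lambda$ containing $v_0,v_1$, closed under the supercommutator and, if $\operatorname{char}K=2$, also under $a\mapsto a^2$ for odd elements $a$. $\mathbf A=\operatorname{Alg}(v_0,v_1)$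 is the associative subalgebra (without unit) generated by $v_0,v_1$. Both are $\mathbb Z^2$-graded by multidegree in $v_0,v_1$ with components $\mathbf R_{n_1,n_2}$, $\mathbf A_{n_1,n_2}$ (spanned by monomials with $n_1$ factors $v_0$ and $n_2$ factors $v_1$). The superweight of the $(n_1,n_2)$ component is $n_1-n_2$, so $\mathbf R_+,\mathbf R_0,\mathbf R_-$ are the sums of the $\mathbf R_{n_1,n_2}$ with $n_1>n_2$, $n_1=n_2$, $n_1<n_2$, respectively, and similarly for $\mathbf A$. An algebra is locally nilpotent if every finitely generated subalgebra is nilpotent. A Lie superalgebra $L$ is nilpotent if $L^n=0$ for some $n$, where $L^1=L$, $L^n=[L,L^{n-1}]$ (if $\operatorname{char}K=2$, adding to $L^n$ the span of squares of odd elements of $L^{\lceil n/2\rceil}$). *)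

theory Defs
  imports Complex_Main "HOL-Library.Groups_Big_Fun"
begin

section \<open>The Grassmann algebra\<close>

text \<open>
  For a finite set \<open>S\<close> of naturals let \<open>x\<^sub>S\<close> be the product of the \<open>x\<^sub>s\<close>, \<open>s \<in> S\<close>, in increasing order.
  These monomials form a basis of \<open>\<Lambda>\<close>, and an element of \<open>\<Lambda>\<close> is represented by its coefficients.
\<close>

typedef (overloaded) 'k grassmann =
  "{f :: nat set \<Rightarrow> 'k::zero. (\<forall>S. f S \<noteq> 0 \<longrightarrow> finite S) \<and> finite {S. f S \<noteq> 0}}"
  morphisms gcoeff Abs_grassmann
  by (rule exI[of _ "\<lambda>_. 0"]) auto

setup_lifting type_definition_grassmann

text \<open>\<open>x\<^sub>S * x\<^sub>T = gsign S T x\<^bsub>S \<union> T\<^esub>\<close> for disjoint \<open>S\<close> and \<open>T\<close>, and \<open>x\<^sub>S * x\<^sub>T = 0\<close> otherwise.\<close>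

definition gsign :: "nat set \<Rightarrow> nat set \<Rightarrow> 'k::ring_1" where
  "gsign S T = (- 1) ^ card {(s, t). s \<in> S \<and> t \<in> T \<and> t < s}"

lemma gsign_mult_Un:
  assumes "finite S" "finite T" "finite W" "S \<inter> T = {}" "T \<inter> W = {}"
  shows "gsign (S \<union> T) W * gsign S T = (gsign S (T \<union> W) * gsign T W :: 'k::comm_ring_1)"
proof -
  let ?I = "\<lambda>S T. {(s, t). s \<in> S \<and> t \<in> T \<and> t < (s::nat)}"
  have fin: "finite (?I A B)" if "finite A" "finite B" for A B
    by (rule finite_subset[of _ "A \<times> B"]) (use that in auto)
  have "?I (S \<union> T) W = ?I S W \<union> ?I T W" by auto
  moreover have "?I S W \<inter> ?I T W = {}" using assms by auto
  ultimately have 1: "card (?I (S \<union> T) W) = card (?I S W) + card (?I T W)"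
    using fin assms by (simp add: card_Un_disjoint)
  have "?I S (T \<union> W) = ?I S T \<union> ?I S W" by auto
  moreover have "?I S T \<inter> ?I S W = {}" using assms by auto
  ultimately have 2: "card (?I S (T \<union> W)) = card (?I S T) + card (?I S W)"
    using fin assms by (simp add: card_Un_disjoint)
  show ?thesis unfolding gsign_def 1 2 power_add by (simp only: ac_simps)
qed

lemma gsign_empty [simp]: "gsign {} T = 1" "gsign S {} = 1"
  by (simp_all add: gsign_def)

instantiation grassmann :: (comm_ring_1) ring_1
begin

lift_definition zero_grassmann :: "'a grassmann" is "\<lambda>_. 0" by simp

lift_definition one_grassmann :: "'a grassmann" is "\<lambda>S. if S = {} then 1 else 0" by simp

lift_definition plus_grassmann :: "'a grassmann \<Rightarrow> 'a grassmann \<Rightarrow> 'a grassmann"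
  is "\<lambda>f g S. f S + g S"
proof -
  fix f g :: "nat set \<Rightarrow> 'a"
  assume "(\<forall>S. f S \<noteq> 0 \<longrightarrow> finite S) \<and> finite {S. f S \<noteq> 0}"
    and "(\<forall>S. g S \<noteq> 0 \<longrightarrow> finite S) \<and> finite {S. g S \<noteq> 0}"
  moreover from this have "finite {S. f S + g S \<noteq> 0}"
    by (intro finite_subset[of "{S. f S + g S \<noteq> 0}" "{S. f S \<noteq> 0} \<union> {S. g S \<noteq> 0}"]) auto
  ultimately show "(\<forall>S. f S + g S \<noteq> 0 \<longrightarrow> finite S) \<and> finite {S. f S + g S \<noteq> 0}"
    by (metis add_0)
qed

lift_definition uminus_grassmann :: "'a grassmann \<Rightarrow> 'a grassmann" is "\<lambda>f S. - f S" by simp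

lift_definition minus_grassmann :: "'a grassmann \<Rightarrow> 'a grassmann \<Rightarrow> 'a grassmann"
  is "\<lambda>f g S. f S - g S"
proof -
  fix f g :: "nat set \<Rightarrow> 'a"
  assume "(\<forall>S. f S \<noteq> 0 \<longrightarrow> finite S) \<and> finite {S. f S \<noteq> 0}"
    and "(\<forall>S. g S \<noteq> 0 \<longrightarrow> finite S) \<and> finite {S. g S \<noteq> 0}"
  moreover from this have "finite {S. f S - g S \<noteq> 0}"
    by (intro finite_subset[of "{S. f S - g S \<noteq> 0}" "{S. f S \<noteq> 0} \<union> {S. g S \<noteq> 0}"]) auto
  ultimately show "(\<forall>S. f S - g S \<noteq> 0 \<longrightarrow> finite S) \<and> finite {S. f S - g S \<noteq> 0}"
    by (metis diff_0_right)
qed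

lift_definition times_grassmann :: "'a grassmann \<Rightarrow> 'a grassmann \<Rightarrow> 'a grassmann"
  is "\<lambda>f g U. \<Sum>S\<in>Pow U. gsign S (U - S) * f S * g (U - S)"
proof -
  fix f g :: "nat set \<Rightarrow> 'a"
  assume f: "(\<forall>S. f S \<noteq> 0 \<longrightarrow> finite S) \<and> finite {S. f S \<noteq> 0}"
    and g: "(\<forall>S. g S \<noteq> 0 \<longrightarrow> finite S) \<and> finite {S. g S \<noteq> 0}"
  let ?h = "\<lambda>U. \<Sum>S\<in>Pow U. gsign S (U - S) * f S * g (U - S)"
  have "finite U" if "?h U \<noteq> 0" for U
    by (rule ccontr) (use that in simp)
  moreover have "{U. ?h U \<noteq> 0} \<subseteq> (\<lambda>(S, T). S \<union> T) ` ({S. f S \<noteq> 0} \<times> {S. g S \<noteq> 0})"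
  proof
    fix U assume "U \<in> {U. ?h U \<noteq> 0}"
    then have "?h U \<noteq> 0" by simp
    then obtain S where "S \<in> Pow U" "gsign S (U - S) * f S * g (U - S) \<noteq> 0"
      by (rule sum.not_neutral_contains_not_neutral)
    then have "(S, U - S) \<in> {S. f S \<noteq> 0} \<times> {S. g S \<noteq> 0}" "U = S \<union> (U - S)" by auto
    then show "U \<in> (\<lambda>(S, T). S \<union> T) ` ({S. f S \<noteq> 0} \<times> {S. g S \<noteq> 0})"
      by (metis (mono_tags, lifting) case_prod_conv image_eqI)
  qed
  then have "finite {U. ?h U \<noteq> 0}"
    by (rule finite_subset) (use f g in auto)
  ultimately show "(\<forall>U. ?h U \<noteq> 0 \<longrightarrow> finite U) \<and> finite {U. ?h U \<noteq> 0}"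
    by blast
qed

lemma grassmann_eqI: "(\<And>S. gcoeff f S = gcoeff g S) \<Longrightarrow> f = g"
  by (simp add: gcoeff_inject[symmetric] fun_eq_iff)

lemma gcoeff_infinite: "infinite U \<Longrightarrow> gcoeff f U = 0"
  using gcoeff[of f] by auto

instance
proof
  fix a b c :: "'a grassmann"
  show "a * b * c = a * (b * c)"
  proof (rule gcoeff_inject[THEN iffD1], rule ext)
    fix U
    show "gcoeff (a * b * c) U = gcoeff (a * (b * c)) U"
    proof (cases "finite U")
      case True
      let ?a = "gcoeff a" and ?b = "gcoeff b" and ?c = "gcoeff c"
      have "gcoeff (a * b * c) U = (\<Sum>V\<in>Pow U. \<Sum>S\<in>Pow V.
          gsign V (U - V) * gsign S (V - S) * ?a S * ?b (V - S) * ?c (U - V))"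
        by (simp add: times_grassmann.rep_eq sum_distrib_left sum_distrib_right mult.assoc)
      also have "\<dots> = (\<Sum>(V, S)\<in>Sigma (Pow U) Pow.
          gsign V (U - V) * gsign S (V - S) * ?a S * ?b (V - S) * ?c (U - V))"
        by (rule sum.Sigma) (use True in \<open>auto intro: finite_subset\<close>)
      also have "\<dots> = (\<Sum>(S, T)\<in>Sigma (Pow U) (\<lambda>S. Pow (U - S)).
          gsign S (U - S) * gsign T (U - S - T) * ?a S * ?b T * ?c (U - S - T))"
      proof (rule sum.reindex_bij_witness[where i = "\<lambda>(S, T). (S \<union> T, S)" and j = "\<lambda>(V, S). (S, V - S)"])
        fix p assume "p \<in> Sigma (Pow U) Pow"
        then obtain V S where p: "p = (V, S)" "V \<subseteq> U" "S \<subseteq> V" by auto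
        have fin: "finite V" "finite S" using p True by (meson finite_subset)+
        have eq: "S \<union> (V - S) = V" "V - S \<union> (U - V) = U - S" "U - S - (V - S) = U - V" using p by auto
        have "gsign (S \<union> (V - S)) (U - V) * gsign S (V - S)
              = (gsign S (V - S \<union> (U - V)) * gsign (V - S) (U - V) :: 'a)"
          by (rule gsign_mult_Un) (use True fin in auto)
        then have "gsign V (U - V) * gsign S (V - S) = (gsign S (U - S) * gsign (V - S) (U - V) :: 'a)"
          unfolding eq .
        then show "(case case p of (V, S) \<Rightarrow> (S, V - S) of (S, T) \<Rightarrow>
              gsign S (U - S) * gsign T (U - S - T) * ?a S * ?b T * ?c (U - S - T))
            = (case p of (V, S) \<Rightarrow> gsign V (U - V) * gsign S (V - S) * ?a S * ?b (V - S) * ?c (U - V))"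
          by (simp add: p eq)
      qed auto
      also have "\<dots> = (\<Sum>S\<in>Pow U. \<Sum>T\<in>Pow (U - S).
          gsign S (U - S) * gsign T (U - S - T) * ?a S * ?b T * ?c (U - S - T))"
        by (rule sum.Sigma[symmetric]) (use True in auto)
      also have "\<dots> = gcoeff (a * (b * c)) U"
        by (simp add: times_grassmann.rep_eq sum_distrib_left ac_simps)
      finally show ?thesis .
    qed (simp add: gcoeff_infinite)
  qed
  show "1 * a = a"
  proof (rule gcoeff_inject[THEN iffD1], rule ext)
    fix U show "gcoeff (1 * a) U = gcoeff a U"
    proof (cases "finite U")
      case True
      have "gcoeff (1 * a) U = (\<Sum>S\<in>Pow U. if S = {} then gcoeff a U else 0)"
        unfolding times_grassmann.rep_eq one_grassmann.rep_eq by (rule sum.cong) auto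
      then show ?thesis using True by simp
    qed (simp add: gcoeff_infinite)
  qed
  show "a * 1 = a"
  proof (rule gcoeff_inject[THEN iffD1], rule ext)
    fix U show "gcoeff (a * 1) U = gcoeff a U"
    proof (cases "finite U")
      case True
      have "gcoeff (a * 1) U = (\<Sum>S\<in>Pow U. if S = U then gcoeff a U else 0)"
        unfolding times_grassmann.rep_eq one_grassmann.rep_eq by (rule sum.cong) auto
      then show ?thesis using True by simp
    qed (simp add: gcoeff_infinite)
  qed
  show "(a + b) * c = a * c + b * c"
    by transfer (simp add: algebra_simps sum.distrib)
  show "a * (b + c) = a * b + a * c"
    by transfer (simp add: algebra_simps sum.distrib)
  show "(0::'a grassmann) \<noteq> 1" by transfer (metis zero_neq_one)
qed (transfer; simp add: algebra_simps)+

end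

lift_definition gscale :: "'k::comm_ring_1 \<Rightarrow> 'k grassmann \<Rightarrow> 'k grassmann"
  is "\<lambda>c f S. c * f S"
proof -
  fix c :: 'k and f :: "nat set \<Rightarrow> 'k"
  assume "(\<forall>S. f S \<noteq> 0 \<longrightarrow> finite S) \<and> finite {S. f S \<noteq> 0}"
  moreover from this have "finite {S. c * f S \<noteq> 0}"
    by (intro finite_subset[of "{S. c * f S \<noteq> 0}" "{S. f S \<noteq> 0}"]) auto
  moreover have "f S \<noteq> 0" if "c * f S \<noteq> 0" for S using that by auto
  ultimately show "(\<forall>S. c * f S \<noteq> 0 \<longrightarrow> finite S) \<and> finite {S. c * f S \<noteq> 0}" by blast
qed

global_interpretation grassmann: vector_space gscale
  by unfold_locales (transfer; simp add: algebra_simps)+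

lemma gscale_mult: "gscale c f * g = gscale c (f * g)" "f * gscale c g = gscale c (f * g)"
  by (transfer; simp add: sum_distrib_left ac_simps)+

lift_definition gen :: "nat \<Rightarrow> 'k::zero_neq_one grassmann"
  is "\<lambda>i S. if S = {i} then 1 else 0" by simp

text \<open>The \<open>\<int>\<^sub>2\<close>-grading; throughout, a natural number \<open>d\<close> stands for its residue modulo 2.\<close>

definition gcomp :: "nat \<Rightarrow> 'k::zero grassmann set" where
  "gcomp d = {f. \<forall>S. gcoeff f S \<noteq> 0 \<longrightarrow> even (card S + d)}"

lift_definition gproj :: "nat \<Rightarrow> 'k::zero grassmann \<Rightarrow> 'k grassmann"
  is "\<lambda>d f S. if even (card S + d) then f S else 0"
  by (auto elim!: rev_finite_subset)

lemma gproj_in_gcomp: "gproj d f \<in> gcomp d"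
  by (simp add: gcomp_def gproj.rep_eq)

lemma gproj_sum: "gproj 0 f + gproj 1 f = f"
  for f :: "'k::comm_ring_1 grassmann"
  by (rule grassmann_eqI) (simp add: gproj.rep_eq plus_grassmann.rep_eq)

lemma gcomp_parity: "even (c + d) \<Longrightarrow> gcomp c = gcomp d"
  by (auto simp: gcomp_def)

lemma gproj_parity: "even (c + d) \<Longrightarrow> gproj c f = gproj d f"
  by (rule grassmann_eqI) (auto simp: gproj.rep_eq)

lemma gproj_id: "f \<in> gcomp c \<Longrightarrow> even (c + d) \<Longrightarrow> gproj d f = f"
  by (rule grassmann_eqI) (auto simp: gproj.rep_eq gcomp_def)

lemma gproj_zero: "f \<in> gcomp c \<Longrightarrow> odd (c + d) \<Longrightarrow> gproj d f = 0"
  by (rule grassmann_eqI) (auto simp: gproj.rep_eq gcomp_def zero_grassmann.rep_eq)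

lemma gproj_0 [simp]: "gproj d 0 = 0"
  by (rule grassmann_eqI) (simp add: gproj.rep_eq zero_grassmann.rep_eq)

lemma gcomp_mult:
  fixes f g :: "'k::comm_ring_1 grassmann"
  assumes "f \<in> gcomp d" "g \<in> gcomp e"
  shows "f * g \<in> gcomp (d + e)"
  unfolding gcomp_def mem_Collect_eq
proof (intro allI impI)
  fix U assume nz: "gcoeff (f * g) U \<noteq> 0"
  then have fin: "finite U" using gcoeff_infinite by blast
  from nz have "(\<Sum>S\<in>Pow U. gsign S (U - S) * gcoeff f S * gcoeff g (U - S)) \<noteq> 0"
    by (simp add: times_grassmann.rep_eq)
  then obtain S where S: "S \<in> Pow U" "gsign S (U - S) * gcoeff f S * gcoeff g (U - S) \<noteq> 0"
    by (rule sum.not_neutral_contains_not_neutral)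
  then have "gcoeff f S \<noteq> 0" "gcoeff g (U - S) \<noteq> 0" by auto
  then have "even (card S + d)" "even (card (U - S) + e)"
    using assms by (auto simp: gcomp_def)
  moreover have "card U = card S + card (U - S)"
    using S(1) fin by (metis PowD card_Un_disjoint Diff_disjoint Un_Diff_cancel finite_Diff finite_subset sup.absorb2)
  ultimately show "even (card U + (d + e))" by auto
qed

text \<open>
  The partial superderivative: \<open>\<partial>\<^sub>i x\<^sub>S = (- 1)\<^sup>k x\<^bsub>S - {i}\<^esub>\<close> if \<open>i \<in> S\<close>, where \<open>k\<close> counts the elements of \<open>S\<close>
  below \<open>i\<close>, and \<open>\<partial>\<^sub>i x\<^sub>S = 0\<close> otherwise.  It is characterised by the lemma
  \<open>odd_superderivation_iff_pderiv\<close> below.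
\<close>

lift_definition gpd :: "nat \<Rightarrow> 'k::comm_ring_1 grassmann \<Rightarrow> 'k grassmann"
  is "\<lambda>i f S. if i \<in> S then 0 else (- 1) ^ card {s \<in> S. s < i} * f (insert i S)"
proof -
  fix i :: nat and f :: "nat set \<Rightarrow> 'k"
  assume f: "(\<forall>S. f S \<noteq> 0 \<longrightarrow> finite S) \<and> finite {S. f S \<noteq> 0}"
  let ?h = "\<lambda>S. if i \<in> S then 0 else (- 1) ^ card {s \<in> S. s < i} * f (insert i S)"
  have "{S. ?h S \<noteq> 0} \<subseteq> (\<lambda>S. S - {i}) ` {S. f S \<noteq> 0}"
  proof
    fix S assume "S \<in> {S. ?h S \<noteq> 0}"
    then have "i \<notin> S" "f (insert i S) \<noteq> 0" by (auto split: if_splits)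
    then show "S \<in> (\<lambda>S. S - {i}) ` {S. f S \<noteq> 0}"
      by (intro image_eqI[of _ _ "insert i S"]) auto
  qed
  then have "finite {S. ?h S \<noteq> 0}" by (rule finite_subset) (use f in auto)
  moreover have "finite S" if "?h S \<noteq> 0" for S
    using that f by (metis finite_insert mult_zero_right)
  ultimately show "(\<forall>S. ?h S \<noteq> 0 \<longrightarrow> finite S) \<and> finite {S. ?h S \<noteq> 0}"
    by blast
qed

lemma gpd_add: "gpd i (f + g) = gpd i f + gpd i g"
  by transfer (auto simp: algebra_simps)

lemma gpd_scale: "gpd i (gscale c f) = gscale c (gpd i f)"
  by transfer (auto simp: algebra_simps)

lemma finite_gpd_nonzero: "finite {i. gpd i f \<noteq> 0}"
proof (rule finite_subset)
  show "{i. gpd i f \<noteq> 0} \<subseteq> \<Union> {S. gcoeff f S \<noteq> 0}"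
  proof
    fix i assume "i \<in> {i. gpd i f \<noteq> 0}"
    then obtain S where "gcoeff (gpd i f) S \<noteq> 0"
      by (metis (mono_tags) grassmann_eqI mem_Collect_eq zero_grassmann.rep_eq)
    then have "gcoeff f (insert i S) \<noteq> 0"
      by (auto simp: gpd.rep_eq split: if_splits)
    then show "i \<in> \<Union> {S. gcoeff f S \<noteq> 0}" by blast
  qed
  show "finite (\<Union> {S. gcoeff f S \<noteq> 0})"
    using gcoeff[of f] by auto
qed

section \<open>Endomorphisms of the Grassmann algebra\<close>

typedef (overloaded) 'k endo =
  "{a :: 'k::field grassmann \<Rightarrow> 'k grassmann. Vector_Spaces.linear gscale gscale a}"
  morphisms app Abs_endo
  by (rule exI[of _ id]) (simp add: grassmann.linear_id)

setup_lifting type_definition_endo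

lemma linear_gscale_iff:
  "Vector_Spaces.linear gscale gscale a \<longleftrightarrow>
    (\<forall>f g. a (f + g) = a f + a g) \<and> (\<forall>c f. a (gscale c f) = gscale c (a f))"
  for a :: "'k::field grassmann \<Rightarrow> 'k grassmann"
  by (simp add: Vector_Spaces.linear_iff grassmann.vector_space_axioms)

lemma app_add [simp]: "app a (f + g) = app a f + app a g"
  and app_gscale [simp]: "app a (gscale c f) = gscale c (app a f)"
  using app[of a] by (simp_all add: linear_gscale_iff)

lemma app_zero [simp]: "app a 0 = 0"
  using app_add[of a 0 0] by simp

text \<open>Multiplication in \<open>End \<Lambda>\<close> is composition.\<close>

instantiation endo :: (field) ring_1
begin

lift_definition zero_endo :: "'a endo" is "\<lambda>_. 0"
  by (simp add: linear_gscale_iff)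
lift_definition one_endo :: "'a endo" is "\<lambda>f. f"
  by (simp add: linear_gscale_iff)
lift_definition plus_endo :: "'a endo \<Rightarrow> 'a endo \<Rightarrow> 'a endo" is "\<lambda>a b f. a f + b f"
  by (simp add: linear_gscale_iff grassmann.scale_right_distrib)
lift_definition uminus_endo :: "'a endo \<Rightarrow> 'a endo" is "\<lambda>a f. - a f"
  by (simp add: linear_gscale_iff)
lift_definition minus_endo :: "'a endo \<Rightarrow> 'a endo \<Rightarrow> 'a endo" is "\<lambda>a b f. a f - b f"
  by (simp add: linear_gscale_iff grassmann.scale_right_diff_distrib)
lift_definition times_endo :: "'a endo \<Rightarrow> 'a endo \<Rightarrow> 'a endo" is "\<lambda>a b f. a (b f)"
  by (simp add: linear_gscale_iff)

instance
proof
  fix a b c :: "'a endo"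
  show "a * b * c = a * (b * c)" by transfer simp
  show "1 * a = a" by transfer simp
  show "a * 1 = a" by transfer simp
  show "(a + b) * c = a * c + b * c" by transfer simp
  show "a * (b + c) = a * b + a * c" by transfer (simp add: linear_gscale_iff)
  show "(0 :: 'a endo) \<noteq> 1" by transfer (metis zero_neq_one)
qed (transfer; simp add: algebra_simps)+

end

lift_definition escale :: "'k::field \<Rightarrow> 'k endo \<Rightarrow> 'k endo" is "\<lambda>c a f. gscale c (a f)"
  by (simp add: linear_gscale_iff grassmann.scale_right_distrib grassmann.scale_left_commute)

global_interpretation endo: vector_space escale
  by unfold_locales
    (transfer; simp add: grassmann.scale_right_distrib grassmann.scale_left_distrib)+

definition lmul :: "'k::field grassmann \<Rightarrow> 'k endo" where
  "lmul g = Abs_endo (\<lambda>f. g * f)"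

lemma app_lmul [simp]: "app (lmul g) f = g * f"
  unfolding lmul_def by (subst Abs_endo_inverse) (simp_all add: linear_gscale_iff distrib_left gscale_mult)

lift_definition pderiv :: "nat \<Rightarrow> 'k::field endo" is gpd
  by (simp add: linear_gscale_iff gpd_add gpd_scale)

text \<open>
  \<open>End \<Lambda>\<close> is itself \<open>\<int>\<^sub>2\<close>-graded; \<open>ehom d a\<close> says that \<open>a\<close> is homogeneous of degree \<open>d\<close>, and
  \<open>ecomp d a\<close> is the homogeneous component of degree \<open>d\<close> of an arbitrary \<open>a\<close>.
\<close>

definition ehom :: "nat \<Rightarrow> 'k::field endo \<Rightarrow> bool" where
  "ehom d a \<longleftrightarrow> (\<forall>c. \<forall>f\<in>gcomp c. app a f \<in> gcomp (c + d))"

lift_definition par :: "nat \<Rightarrow> 'k::field endo" is gproj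
  unfolding linear_gscale_iff
  by (intro conjI allI grassmann_eqI) (simp_all add: gproj.rep_eq plus_grassmann.rep_eq gscale.rep_eq)

definition ecomp :: "nat \<Rightarrow> 'k::field endo \<Rightarrow> 'k endo" where
  "ecomp d a = (\<Sum>c<2. par (c + d) * a * par c)"

lemma lessThan_2: "{..<2::nat} = {0, 1}" by auto

lemma app_ecomp: "app (ecomp d a) f = gproj d (app a (gproj 0 f)) + gproj (1 + d) (app a (gproj 1 f))"
  by (simp add: ecomp_def lessThan_2 plus_endo.rep_eq times_endo.rep_eq par.rep_eq)

lemma ecomp_sum: "ecomp 0 a + ecomp 1 a = a"
proof -
  have "app (ecomp 0 a + ecomp 1 a) f = app a f" for f
  proof -
    have "app (ecomp 0 a + ecomp 1 a) f =
        (gproj 0 (app a (gproj 0 f)) + gproj 1 (app a (gproj 0 f))) +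
        (gproj 0 (app a (gproj 1 f)) + gproj 1 (app a (gproj 1 f)))"
      using gproj_parity[of "Suc (Suc 0)" 0] by (simp add: plus_endo.rep_eq app_ecomp)
    also have "\<dots> = app a (gproj 0 f + gproj 1 f)"
      by (simp only: gproj_sum flip: app_add)
    also have "\<dots> = app a f" by (simp only: gproj_sum)
    finally show ?thesis .
  qed
  then show ?thesis by (metis app_inject ext)
qed

lemma ehom_ecomp: "ehom d (ecomp d a)"
  for a :: "'k::field endo"
  unfolding ehom_def
proof (intro allI ballI)
  fix c and f :: "'k grassmann" assume f: "f \<in> gcomp c"
  show "app (ecomp d a) f \<in> gcomp (c + d)"
  proof (cases "even c")
    case True
    then have "gproj 1 f = 0" using gproj_zero[OF f] by simp
    then have "app (ecomp d a) f = gproj d (app a (gproj 0 f))"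
      by (simp add: app_ecomp)
    moreover have "gcomp (c + d) = gcomp d" using True by (intro gcomp_parity) auto
    ultimately show ?thesis using gproj_in_gcomp by metis
  next
    case False
    then have "gproj 0 f = 0" using gproj_zero[OF f] by simp
    then have "app (ecomp d a) f = gproj (1 + d) (app a (gproj 1 f))"
      by (simp add: app_ecomp)
    moreover have "gcomp (c + d) = gcomp (1 + d)" using False by (intro gcomp_parity) auto
    ultimately show ?thesis using gproj_in_gcomp by metis
  qed
qed

lemma ecomp_ehom:
  assumes "ehom d a"
  shows "ecomp e a = (if even (d + e) then a else 0)"
proof -
  have "app (ecomp e a) f = (if even (d + e) then app a f else 0)" for f
  proof -
    have m: "app a (gproj 0 f) \<in> gcomp d" "app a (gproj 1 f) \<in> gcomp (1 + d)"
      using assms gproj_in_gcomp[of 0 f] gproj_in_gcomp[of 1 f] unfolding ehom_def by force+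
    show ?thesis
    proof (cases "even (d + e)")
      case True
      have "gproj e (app a (gproj 0 f)) = app a (gproj 0 f)"
        by (rule gproj_id[OF m(1) True])
      moreover have "even (1 + d + (1 + e))" using True by simp
      then have "gproj (1 + e) (app a (gproj 1 f)) = app a (gproj 1 f)"
        by (rule gproj_id[OF m(2)])
      moreover have "app a (gproj 0 f) + app a (gproj 1 f) = app a f"
        by (simp only: gproj_sum flip: app_add)
      ultimately show ?thesis using True by (simp add: app_ecomp)
    next
      case False
      have "odd (1 + d + (1 + e))" using False by simp
      then show ?thesis
        using False gproj_zero[OF m(1), of e] gproj_zero[OF m(2), of "1 + e"] by (simp add: app_ecomp)
    qed
  qed
  then have "app (ecomp e a) = app (if even (d + e) then a else 0)"
    by (auto simp: fun_eq_iff zero_endo.rep_eq)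
  then show ?thesis by (simp only: app_inject)
qed

text \<open>
  The supercommutator \<open>[a, b] = a b - (- 1)\<^bsup>deg a deg b\<^esup> b a\<close> of homogeneous elements, extended bilinearly
  (see \<open>scomm_ehom\<close>).
\<close>

definition scomm :: "'k::field endo \<Rightarrow> 'k endo \<Rightarrow> 'k endo" where
  "scomm a b = (\<Sum>d<2. \<Sum>e<2. ecomp d a * ecomp e b - (- 1) ^ (d * e) * (ecomp e b * ecomp d a))"

lemma scomm_ehom:
  assumes "ehom d a" "ehom e b"
  shows "scomm a b = a * b - (- 1) ^ (d * e) * (b * a)"
  unfolding scomm_def lessThan_2 ecomp_ehom[OF assms(1)] ecomp_ehom[OF assms(2)]
  by (cases "even d"; cases "even e") (simp_all add: minus_one_power_iff)

definition odd_superderivation :: "'k::field endo \<Rightarrow> bool" where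
  "odd_superderivation D \<longleftrightarrow> ehom 1 D \<and>
    (\<forall>c. \<forall>f\<in>gcomp c. \<forall>g. app D (f * g) = app D f * g + (- 1) ^ c * (f * app D g))"

lemma gsign_insert_left:
  assumes "finite S" "finite T" "i \<notin> S"
  shows "gsign (insert i S) T = gsign S T * (- 1) ^ card {t \<in> T. t < i}"
proof -
  let ?I = "{(s, t). s \<in> S \<and> t \<in> T \<and> t < s}"
  have "{(s, t). s \<in> insert i S \<and> t \<in> T \<and> t < s} = ?I \<union> Pair i ` {t \<in> T. t < i}" by auto
  moreover have "?I \<inter> Pair i ` {t \<in> T. t < i} = {}" using assms by auto
  moreover have "finite ?I" by (rule finite_subset[of _ "S \<times> T"]) (use assms in auto)
  ultimately have "card {(s, t). s \<in> insert i S \<and> t \<in> T \<and> t < s} = card ?I + card {t \<in> T. t < i}"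
    using assms by (simp add: card_Un_disjoint card_image inj_on_def)
  then show ?thesis by (simp add: gsign_def power_add)
qed

lemma gsign_insert_right:
  assumes "finite S" "finite T" "i \<notin> S" "i \<notin> T"
  shows "gsign S (insert i T) = gsign S T * (- 1) ^ card S * (- 1) ^ card {s \<in> S. s < i}"
proof -
  let ?I = "{(s, t). s \<in> S \<and> t \<in> T \<and> t < s}" and ?G = "{s \<in> S. i < s}" and ?L = "{s \<in> S. s < i}"
  have "{(s, t). s \<in> S \<and> t \<in> insert i T \<and> t < s} = ?I \<union> (\<lambda>s. (s, i)) ` ?G" by auto
  moreover have "?I \<inter> (\<lambda>s. (s, i)) ` ?G = {}" using assms by auto
  moreover have "finite ?I" by (rule finite_subset[of _ "S \<times> T"]) (use assms in auto)
  ultimately have 1: "card {(s, t). s \<in> S \<and> t \<in> insert i T \<and> t < s} = card ?I + card ?G"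
    using assms by (simp add: card_Un_disjoint card_image inj_on_def)
  have "S = ?G \<union> ?L" using assms(3) by (auto simp: not_less_iff_gr_or_eq)
  then have "card S = card (?G \<union> ?L)" by metis
  also have "\<dots> = card ?G + card ?L" by (rule card_Un_disjoint) (use assms in auto)
  finally have 2: "card S = card ?G + card ?L" .
  show ?thesis unfolding gsign_def 1 2 power_add
    by (simp add: mult.assoc minus_one_power_iff)
qed

lemma minus_one_power_gmult: "(- 1) ^ n * f = gscale ((- 1) ^ n) f"
  for f :: "'k::field grassmann"
  by (cases "even n") simp_all

lemma gpd_mult:
  fixes f g :: "'k::field grassmann"
  assumes f: "f \<in> gcomp c"
  shows "gpd i (f * g) = gpd i f * g + (- 1) ^ c * (f * gpd i g)"
proof (rule grassmann_eqI)
  fix U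
  let ?f = "gcoeff f" and ?g = "gcoeff g" and ?P = "\<lambda>S. (- 1) ^ card {s \<in> S. s < i} :: 'k"
  have PP: "?P S * ?P S = 1" for S by (simp flip: power_mult_distrib)
  have rhs: "gcoeff (gpd i f * g + (- 1) ^ c * (f * gpd i g)) U =
      (\<Sum>S\<in>Pow U. gsign S (U - S) * gcoeff (gpd i f) S * ?g (U - S)
        + (- 1) ^ c * (gsign S (U - S) * ?f S * gcoeff (gpd i g) (U - S)))"
    by (simp add: minus_one_power_gmult plus_grassmann.rep_eq gscale.rep_eq times_grassmann.rep_eq
        sum.distrib sum_distrib_left)
  have par: "?f S = 0 \<or> (- 1) ^ c = ((- 1) ^ card S :: 'k)" for S
    using f by (auto simp: gcomp_def minus_one_power_iff)
  consider "infinite U" | "finite U" "i \<notin> U" | V where "finite V" "i \<notin> V" "U = insert i V"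
    by (metis finite_insert mk_disjoint_insert)
  then show "gcoeff (gpd i (f * g)) U = gcoeff (gpd i f * g + (- 1) ^ c * (f * gpd i g)) U"
  proof cases
    case 1 then show ?thesis by (simp add: gcoeff_infinite)
  next
    case 2
    let ?t = "\<lambda>S. gsign S (insert i U - S) * ?f S * ?g (insert i U - S)"
    have inj: "inj_on (insert i) (Pow U)" using 2 by (auto intro!: inj_onI)
    have "gcoeff (gpd i (f * g)) U = ?P U * (\<Sum>S\<in>Pow U \<union> insert i ` Pow U. ?t S)"
      using 2 by (simp add: gpd.rep_eq times_grassmann.rep_eq Pow_insert)
    also have "\<dots> = ?P U * ((\<Sum>S\<in>Pow U. ?t S) + (\<Sum>S\<in>insert i ` Pow U. ?t S))"
      using 2 by (subst sum.union_disjoint) auto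
    also have "\<dots> = (\<Sum>S\<in>Pow U. ?P U * ?t (insert i S) + ?P U * ?t S)"
      unfolding sum.reindex[OF inj] by (simp add: sum.distrib sum_distrib_left distrib_left)
    also have "\<dots> = gcoeff (gpd i f * g + (- 1) ^ c * (f * gpd i g)) U"
      unfolding rhs
    proof (rule sum.cong[OF refl])
      fix S assume "S \<in> Pow U"
      then have S: "S \<subseteq> U" "finite S" "finite (U - S)" "i \<notin> S" "i \<notin> U - S"
        using 2 by (auto intro: finite_subset)
      have "{s \<in> U. s < i} = {s \<in> S. s < i} \<union> {s \<in> U - S. s < i}" using S by auto
      then have "card {s \<in> U. s < i} = card {s \<in> S. s < i} + card {s \<in> U - S. s < i}"
        using S by (simp only:) (subst card_Un_disjoint, auto)
      then have P: "?P U = ?P S * ?P (U - S)" by (simp add: power_add)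
      have d: "insert i U - insert i S = U - S" "insert i U - S = insert i (U - S)"
        using S 2 by auto
      have "?P U * ?t (insert i S) = gsign S (U - S) * gcoeff (gpd i f) S * ?g (U - S)"
      proof -
        have "?P U * ?t (insert i S) =
            (?P (U - S) * ?P (U - S)) * (gsign S (U - S) * (?P S * ?f (insert i S)) * ?g (U - S))"
          unfolding d P gsign_insert_left[OF S(2,3,4)] by (simp only: ac_simps)
        then show ?thesis using S by (simp add: PP gpd.rep_eq)
      qed
      moreover have "?P U * ?t S = (- 1) ^ c * (gsign S (U - S) * ?f S * gcoeff (gpd i g) (U - S))"
      proof -
        have "?P U * ?t S = (?P S * ?P S) *
            ((- 1) ^ card S * (gsign S (U - S) * ?f S * (?P (U - S) * ?g (insert i (U - S)))))"
          unfolding d P gsign_insert_right[OF S(2-5)] by (simp only: ac_simps)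
        then show ?thesis using S par[of S] by (auto simp: PP gpd.rep_eq)
      qed
      ultimately show "?P U * ?t (insert i S) + ?P U * ?t S =
          gsign S (U - S) * gcoeff (gpd i f) S * ?g (U - S)
          + (- 1) ^ c * (gsign S (U - S) * ?f S * gcoeff (gpd i g) (U - S))" by simp
    qed
    finally show ?thesis .
  next
    case 3
    let ?t = "\<lambda>S. gsign S (U - S) * gcoeff (gpd i f) S * ?g (U - S)
        + (- 1) ^ c * (gsign S (U - S) * ?f S * gcoeff (gpd i g) (U - S))"
    have inj: "inj_on (insert i) (Pow V)" using 3 by (auto intro!: inj_onI)
    have "gcoeff (gpd i f * g + (- 1) ^ c * (f * gpd i g)) U = (\<Sum>S\<in>Pow V \<union> insert i ` Pow V. ?t S)"
      unfolding rhs using 3 by (simp add: Pow_insert)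
    also have "\<dots> = (\<Sum>S\<in>Pow V. ?t S) + (\<Sum>S\<in>insert i ` Pow V. ?t S)"
      using 3 by (intro sum.union_disjoint) auto
    also have "\<dots> = (\<Sum>S\<in>Pow V. ?t S + ?t (insert i S))"
      unfolding sum.reindex[OF inj] by (simp only: sum.distrib comp_def)
    also have "\<dots> = 0"
    proof (rule sum.neutral, rule ballI)
      fix S assume "S \<in> Pow V"
      then have S: "S \<subseteq> V" "finite S" "finite (V - S)" "i \<notin> S" "i \<notin> V - S"
        using 3 by (auto intro: finite_subset)
      have d: "U - insert i S = V - S" "U - S = insert i (V - S)" using S 3 by auto
      have "?t S = gsign S (V - S) * (- 1) ^ card S * (?P S * ?P S) * ?f (insert i S) * ?g (insert i (V - S))"
        using S unfolding d gsign_insert_right[OF S(2-5)] by (simp add: gpd.rep_eq ac_simps)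
      moreover have "?t (insert i S) = (- 1) ^ c * gsign S (V - S) * (?P (V - S) * ?P (V - S)) *
          ?f (insert i S) * ?g (insert i (V - S))"
        using S unfolding d gsign_insert_left[OF S(2-4)] by (simp add: gpd.rep_eq ac_simps)
      ultimately show "?t S + ?t (insert i S) = 0"
        using par[of "insert i S"] S by (auto simp: PP)
    qed
    finally show ?thesis using 3 by (simp add: gpd.rep_eq)
  qed
qed

lemma odd_superderivation_pderiv: "odd_superderivation (pderiv i :: 'k::field endo)"
  unfolding odd_superderivation_def
proof (intro conjI allI ballI)
  show "ehom 1 (pderiv i :: 'k endo)"
    unfolding ehom_def
  proof (intro allI ballI)
    fix c and f :: "'k grassmann" assume f: "f \<in> gcomp c"
    have "even (card S + (c + 1))" if "gcoeff (gpd i f) S \<noteq> 0" for S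
    proof -
      from that have "finite S" using gcoeff_infinite by blast
      moreover from that have "i \<notin> S" "gcoeff f (insert i S) \<noteq> 0"
        by (auto simp: gpd.rep_eq split: if_splits)
      ultimately show ?thesis using f unfolding gcomp_def by fastforce
    qed
    then show "app (pderiv i) f \<in> gcomp (c + 1)"
      by (simp add: pderiv.rep_eq gcomp_def)
  qed
qed (simp add: pderiv.rep_eq gpd_mult)

lemma pderiv_gen: "app (pderiv i) (gen j) = (if i = j then 1 else 0)"
  by (rule grassmann_eqI)
    (auto simp: pderiv.rep_eq gpd.rep_eq gen.rep_eq one_grassmann.rep_eq zero_grassmann.rep_eq)

lemma gen_in_gcomp: "gen j \<in> gcomp 1"
  by (auto simp: gcomp_def gen.rep_eq split: if_splits)

lemma gcoeff_prod_gen: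
  fixes S :: "nat set"
  assumes "finite S"
  shows "gcoeff (prod_list (map gen (sorted_list_of_set S)) :: 'k::field grassmann) T = (if T = S then 1 else 0)"
  using assms
proof (induction "card S" arbitrary: S T)
  case 0
  then show ?case by (simp add: one_grassmann.rep_eq)
next
  case (Suc n)
  define m where "m = Min S"
  define R where "R = S - {m}"
  let ?p = "prod_list (map gen (sorted_list_of_set R)) :: 'k grassmann"
  have ne: "S \<noteq> {}" using Suc.hyps by auto
  have m: "m \<in> S" "\<And>s. s \<in> R \<Longrightarrow> m < s" "finite R"
    using Suc.prems ne by (auto simp: m_def R_def order_less_le)
  have IH: "gcoeff ?p V = (if V = R then 1 else 0)" for V
    using Suc.hyps m by (intro Suc.hyps(1)) (auto simp: R_def)
  have S: "sorted_list_of_set S = m # sorted_list_of_set R"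
    unfolding m_def R_def using ne Suc.prems by (rule sorted_list_of_set_nonempty[rotated])
  show ?case
  proof (cases "finite T")
    case True
    have "{(s, t). s \<in> {m} \<and> t \<in> R \<and> t < s} = {}" using m(2) by fastforce
    then have sg: "gsign {m} R = (1 :: 'k)" by (simp only: gsign_def card.empty power_0)
    have "gcoeff (gen m * ?p) T = (\<Sum>V\<in>Pow T. if V = {m} then (if T = S then 1 else 0) else 0)"
      unfolding times_grassmann.rep_eq
    proof (rule sum.cong[OF refl])
      fix V assume V: "V \<in> Pow T"
      show "gsign V (T - V) * gcoeff (gen m) V * gcoeff ?p (T - V) = (if V = {m} then (if T = S then 1 else 0) else 0)"
      proof (cases "V = {m}")
        case True
        then have "T - V = R \<longleftrightarrow> T = S" using V m by (auto simp: R_def)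
        then show ?thesis using True sg by (auto simp: gen.rep_eq IH)
      qed (simp add: gen.rep_eq)
    qed
    also have "\<dots> = (if {m} \<in> Pow T then (if T = S then 1 else 0) else 0)"
      using True by (simp add: sum.delta)
    also have "\<dots> = (if T = S then 1 else 0)" using m by auto
    finally show ?thesis by (simp add: S)
  qed (use Suc.prems in \<open>auto simp: gcoeff_infinite\<close>)
qed

lemma grassmann_expansion:
  fixes f :: "'k::field grassmann"
  shows "f = (\<Sum>S | gcoeff f S \<noteq> 0. gscale (gcoeff f S) (prod_list (map gen (sorted_list_of_set S))))"
proof (rule grassmann_eqI)
  fix T
  let ?m = "\<lambda>S. prod_list (map gen (sorted_list_of_set S)) :: 'k grassmann"
  have fin: "finite {S. gcoeff f S \<noteq> 0}" "\<And>S. gcoeff f S \<noteq> 0 \<Longrightarrow> finite S"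
    using gcoeff[of f] by auto
  have sum: "gcoeff (\<Sum>S\<in>A. h S) T = (\<Sum>S\<in>A. gcoeff (h S) T)" for A and h :: "nat set \<Rightarrow> 'k grassmann"
    by (induction A rule: infinite_finite_induct) (simp_all add: zero_grassmann.rep_eq plus_grassmann.rep_eq)
  have "gcoeff (\<Sum>S | gcoeff f S \<noteq> 0. gscale (gcoeff f S) (?m S)) T =
      (\<Sum>S | gcoeff f S \<noteq> 0. if S = T then gcoeff f T else 0)"
    unfolding sum by (rule sum.cong[OF refl]) (use fin in \<open>auto simp: gscale.rep_eq gcoeff_prod_gen\<close>)
  also have "\<dots> = gcoeff f T" using fin by (simp add: sum.delta)
  finally show "gcoeff f T = gcoeff (\<Sum>S | gcoeff f S \<noteq> 0. gscale (gcoeff f S) (?m S)) T" by simp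
qed

lemma odd_superderivation_iff_pderiv:
  fixes D :: "'k::field endo"
  shows "odd_superderivation D \<and> (\<forall>j. app D (gen j) = (if i = j then 1 else 0)) \<longleftrightarrow> D = pderiv i"
proof
  assume D: "odd_superderivation D \<and> (\<forall>j. app D (gen j) = (if i = j then 1 else 0))"
  have leibniz: "app E (f * g) = app E f * g + (- 1) ^ c * (f * app E g)"
    if "odd_superderivation E" "f \<in> gcomp c" for E :: "'k endo" and c f g
    using that unfolding odd_superderivation_def by blast
  have one: "(1 :: 'k grassmann) \<in> gcomp 0"
    by (auto simp: gcomp_def one_grassmann.rep_eq split: if_splits)
  have E1: "app E 1 = 0" if "odd_superderivation E" for E :: "'k endo"
    using leibniz[OF that one, of 1] by simp
  have "app D (prod_list (map gen is)) = app (pderiv i) (prod_list (map gen is))" for "is"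
  proof (induction "is")
    case Nil
    then show ?case using E1 D by (simp add: odd_superderivation_pderiv)
  next
    case (Cons j "is")
    then show ?case
      using leibniz[OF _ gen_in_gcomp] D by (simp add: pderiv_gen odd_superderivation_pderiv)
  qed
  moreover have sum: "app E (\<Sum>S\<in>A. h S) = (\<Sum>S\<in>A. app E (h S))"
    for E :: "'k endo" and A :: "nat set set" and h
    by (induction A rule: infinite_finite_induct) simp_all
  ultimately have "app D f = app (pderiv i) f" for f
    by (subst (1 2) grassmann_expansion[of f]) (simp add: sum)
  then show "D = pderiv i" by (metis app_inject ext)
qed (simp add: odd_superderivation_pderiv pderiv_gen)

section \<open>The pivot elements\<close>

text \<open>
  Unfolding \<open>v\<^sub>i = \<partial>\<^sub>i + x\<^sub>i x\<^sub>i\<^sub>+\<^sub>1 v\<^sub>i\<^sub>+\<^sub>2\<close> gives \<open>v\<^sub>i = \<Sum>\<^sub>k x\<^sub>i x\<^sub>i\<^sub>+\<^sub>1 \<cdots> x\<^sub>i\<^sub>+\<^sub>2\<^sub>k\<^sub>-\<^sub>1 \<partial>\<^sub>i\<^sub>+\<^sub>2\<^sub>k\<close>.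
  On each \<open>f\<close> only finitely many summands are nonzero, so that \<open>Sum_any\<close> is their sum.
\<close>

definition gpivot :: "nat \<Rightarrow> 'k::comm_ring_1 grassmann \<Rightarrow> 'k grassmann" where
  "gpivot i f = Sum_any (\<lambda>k. prod_list (map gen [i..<i + 2 * k]) * gpd (i + 2 * k) f)"

lemma finite_gpivot: "finite {k. prod_list (map gen [i..<i + 2 * k]) * gpd (i + 2 * k) f \<noteq> 0}"
proof (rule finite_subset)
  show "{k. prod_list (map gen [i..<i + 2 * k]) * gpd (i + 2 * k) f \<noteq> 0}
      \<subseteq> (\<lambda>k. i + 2 * k) -` {j. gpd j f \<noteq> 0}" by auto
  show "finite ((\<lambda>k. i + 2 * k) -` {j. gpd j f \<noteq> 0})"
    by (rule finite_vimageI[OF finite_gpd_nonzero]) (auto intro: injI)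
qed

lemma linear_gpivot: "Vector_Spaces.linear gscale gscale (gpivot i)"
  unfolding linear_gscale_iff
proof (intro conjI allI)
  fix f g :: "'a grassmann" and c :: 'a
  show "gpivot i (f + g) = gpivot i f + gpivot i g"
    unfolding gpivot_def gpd_add distrib_left
    by (rule Sum_any.distrib[OF finite_gpivot finite_gpivot])
  have "gpivot i (gscale c f) = (\<Sum>k | prod_list (map gen [i..<i + 2 * k]) * gpd (i + 2 * k) f \<noteq> 0.
      prod_list (map gen [i..<i + 2 * k]) * gpd (i + 2 * k) (gscale c f))"
    unfolding gpivot_def
    by (rule Sum_any.expand_superset[OF finite_gpivot]) (auto simp: gpd_scale gscale_mult)
  also have "\<dots> = gscale c (gpivot i f)"
    unfolding gpivot_def Sum_any.expand_set grassmann.scale_sum_right gpd_scale gscale_mult ..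
  finally show "gpivot i (gscale c f) = gscale c (gpivot i f)" .
qed

lift_definition pivot :: "nat \<Rightarrow> 'k::field endo" is gpivot
  by (rule linear_gpivot)

lemma pivot_rec: "pivot i = pderiv i + lmul (gen i) * lmul (gen (i + 1)) * pivot (i + 2)"
proof -
  have "app (pivot i) f = app (pderiv i + lmul (gen i) * lmul (gen (i + 1)) * pivot (i + 2)) f" for f :: "'a grassmann"
  proof -
    let ?F = "\<lambda>i k. prod_list (map gen [i..<i + 2 * k]) * gpd (i + 2 * k) f"
    obtain N where N: "\<And>k. ?F i k \<noteq> 0 \<Longrightarrow> k < N"
      using finite_gpivot[of i f] by (auto simp: finite_nat_set_iff_bounded)
    obtain M where M: "\<And>k. ?F (i + 2) k \<noteq> 0 \<Longrightarrow> k < M"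
      using finite_gpivot[of "i + 2" f] by (auto simp: finite_nat_set_iff_bounded)
    let ?N = "max N M"
    have "gpivot i f = (\<Sum>k<Suc ?N. ?F i k)"
      unfolding gpivot_def by (rule Sum_any.expand_superset) (use N in fastforce)+
    also have "\<dots> = ?F i 0 + (\<Sum>k<?N. ?F i (Suc k))"
      by (rule sum.lessThan_Suc_shift)
    also have "(\<Sum>k<?N. ?F i (Suc k)) = (\<Sum>k<?N. gen i * gen (i + 1) * ?F (i + 2) k)"
    proof (rule sum.cong[OF refl])
      fix k
      have "[i..<i + 2 * Suc k] = i # (i + 1) # [i + 2..<i + 2 + 2 * k]"
        by (simp add: upt_conv_Cons)
      then show "?F i (Suc k) = gen i * gen (i + 1) * ?F (i + 2) k"
        by (simp add: mult.assoc)
    qed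
    also have "\<dots> = gen i * gen (i + 1) * (\<Sum>k<?N. ?F (i + 2) k)"
      by (simp only: sum_distrib_left)
    also have "(\<Sum>k<?N. ?F (i + 2) k) = gpivot (i + 2) f"
      unfolding gpivot_def by (rule Sum_any.expand_superset[symmetric]) (use M in fastforce)+
    finally show ?thesis
      by (simp add: pivot.rep_eq plus_endo.rep_eq times_endo.rep_eq pderiv.rep_eq mult.assoc)
  qed
  then show ?thesis by (metis app_inject ext)
qed

section \<open>Subalgebras, nilpotency and the triangular decompositions\<close>

definition assoc_subalgebra :: "'k::field endo set \<Rightarrow> bool" where
  "assoc_subalgebra B \<longleftrightarrow> endo.subspace B \<and> (\<forall>a\<in>B. \<forall>b\<in>B. a * b \<in> B)"

text \<open>Subalgebras of Lie superalgebras are understood to be \<open>\<int>\<^sub>2\<close>-graded.\<close>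

definition lie_subalgebra :: "'k::field endo set \<Rightarrow> bool" where
  "lie_subalgebra L \<longleftrightarrow> endo.subspace L \<and> (\<forall>a\<in>L. \<forall>d. ecomp d a \<in> L) \<and>
    (\<forall>a\<in>L. \<forall>b\<in>L. scomm a b \<in> L) \<and> (CHAR('k) = 2 \<longrightarrow> (\<forall>a\<in>L. ehom 1 a \<longrightarrow> a\<^sup>2 \<in> L))"

definition assoc_A :: "'k::field endo set" where
  "assoc_A = assoc_subalgebra hull {pivot 0, pivot 1}"

definition lie_R :: "'k::field endo set" where
  "lie_R = lie_subalgebra hull {pivot 0, pivot 1}"

definition assoc_power :: "'k::field endo set \<Rightarrow> nat \<Rightarrow> 'k endo set" where
  "assoc_power B n = endo.span {prod_list as | as. length as = n \<and> set as \<subseteq> B}"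

definition assoc_nilpotent :: "'k::field endo set \<Rightarrow> bool" where
  "assoc_nilpotent B \<longleftrightarrow> (\<exists>n\<ge>1. assoc_power B n = {0})"

definition assoc_locally_nilpotent :: "'k::field endo set \<Rightarrow> bool" where
  "assoc_locally_nilpotent B \<longleftrightarrow>
    (\<forall>F. finite F \<and> F \<subseteq> B \<longrightarrow> assoc_nilpotent (assoc_subalgebra hull F))"

text \<open>
  \<open>L\<^sup>1 = L\<close> and \<open>L\<^sup>n = [L, L\<^sup>n\<^sup>-\<^sup>1]\<close>, augmented in characteristic 2 by the squares of the odd elements of
  \<open>L\<^sup>m\<close> with \<open>m = \<lceil>n / 2\<rceil>\<close>.  The value at \<open>n = 0\<close> is a dummy.
\<close>

fun lie_power :: "'k::field endo set \<Rightarrow> nat \<Rightarrow> 'k endo set" where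
  "lie_power L n = (if n \<le> 1 then L else
     endo.span ({scomm a b | a b. a \<in> L \<and> b \<in> lie_power L (n - 1)} \<union>
       (if CHAR('k) = 2 then {a\<^sup>2 | a. a \<in> lie_power L ((n + 1) div 2) \<and> ehom 1 a} else {})))"

declare lie_power.simps [simp del]

definition lie_nilpotent :: "'k::field endo set \<Rightarrow> bool" where
  "lie_nilpotent L \<longleftrightarrow> (\<exists>n\<ge>1. lie_power L n = {0})"

definition lie_locally_nilpotent :: "'k::field endo set \<Rightarrow> bool" where
  "lie_locally_nilpotent L \<longleftrightarrow>
    (\<forall>F. finite F \<and> F \<subseteq> L \<longrightarrow> lie_nilpotent (lie_subalgebra hull F))"

text \<open>
  The multihomogeneous components.  Since \<open>assoc_A\<close> has no unit, the empty word is excluded.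
\<close>

definition A_comp :: "nat \<Rightarrow> nat \<Rightarrow> 'k::field endo set" where
  "A_comp n m = endo.span {prod_list (map pivot w) | w.
     w \<noteq> [] \<and> set w \<subseteq> {0, 1} \<and> count_list w 0 = n \<and> count_list w 1 = m}"

inductive lie_monomial :: "nat \<Rightarrow> nat \<Rightarrow> 'k::field endo \<Rightarrow> bool" where
  "lie_monomial 1 0 (pivot 0)"
| "lie_monomial 0 1 (pivot 1)"
| "lie_monomial n m a \<Longrightarrow> lie_monomial n' m' b \<Longrightarrow> lie_monomial (n + n') (m + m') (scomm a b)"
| "CHAR('k) = 2 \<Longrightarrow> lie_monomial n m (a :: 'k endo) \<Longrightarrow> ehom 1 a \<Longrightarrow> lie_monomial (2 * n) (2 * m) (a\<^sup>2)"

definition R_comp :: "nat \<Rightarrow> nat \<Rightarrow> 'k::field endo set" where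
  "R_comp n m = endo.span {a. lie_monomial n m a}"

text \<open>The superweight of the component of multidegree \<open>(n, m)\<close> is \<open>n - m\<close>.\<close>

definition A_plus :: "'k::field endo set" where
  "A_plus = endo.span (\<Union>{A_comp n m | n m. n > m})"
definition A_zero :: "'k::field endo set" where
  "A_zero = endo.span (\<Union>{A_comp n m | n m. n = m})"
definition A_minus :: "'k::field endo set" where
  "A_minus = endo.span (\<Union>{A_comp n m | n m. n < m})"

definition R_plus :: "'k::field endo set" where
  "R_plus = endo.span (\<Union>{R_comp n m | n m. n > m})"
definition R_zero :: "'k::field endo set" where
  "R_zero = endo.span (\<Union>{R_comp n m | n m. n = m})"
definition R_minus :: "'k::field endo set" where
  "R_minus = endo.span (\<Union>{R_comp n m | n m. n < m})"

definition direct_sum3 :: "'k::field endo set \<Rightarrow> 'k endo set \<Rightarrow> 'k endo set \<Rightarrow> 'k endo set \<Rightarrow> bool" where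
  "direct_sum3 V X Y Z \<longleftrightarrow> V = {x + y + z | x y z. x \<in> X \<and> y \<in> Y \<and> z \<in> Z} \<and>
    (\<forall>x\<in>X. \<forall>y\<in>Y. \<forall>z\<in>Z. x + y + z = 0 \<longrightarrow> x = 0 \<and> y = 0 \<and> z = 0)"

end

theory Submission
  imports Defs
begin

text \<open>
  Give \<open>x\<^sub>s\<close> the weight \<open>- 2\<^sup>s\<close> and the superweight \<open>- (-
  1)\<^sup>s\<close>. The pivot \<open>v\<^sub>i\<close> replaces some \<open>x\<^sub>j\<close> in a monomial,
  \<open>j - i\<close> even, by \<open>x\<^sub>i \<cdots> x\<^bsub>j-1\<^esub>\<close>, hence raises the weight by
  \<open>2\<^sup>i\<close> and the superweight by \<open>(- 1)\<^sup>i\<close>. So superweight is a grading, which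
  gives the direct sums.

  \<^bold>\<open>Nonzero superweight.\<close> The letters from \<open>x\<^sub>N\<close> on change their weight only in
  multiples \<open>k 2\<^sup>N\<close>, and then their superweight by at most \<open>2 k\<close>. The weight of the
  letters below \<open>x\<^sub>N\<close> varies by less than \<open>2\<^sup>N\<close>, so in an element of weight at
  most \<open>2\<^sup>N\<close> we have \<open>k \<le> 1\<close>. Hence superweight grows at most logarithmically in
  the weight, while in a long product of finitely many elements of \<open>A\<^sub>+\<close> both grow linearly.

  \<^bold>\<open>Superweight zero.\<close> A Lie monomial of degree \<open>(n, n)\<close> is a superderivation of
  weight \<open>3 n\<close>. If \<open>3 n < 2\<^sup>N\<close>, then, as powers of 2 are not divisible by 3, it maps
  every letter into the ideal generated by \<open>x\<^sub>0, \<dots>, x\<^bsub>N-1\<^esub>\<close>. So it either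
  raises the number of these letters in a monomial, or keeps that number and replaces one of them by another one of
  smaller index, and this can happen only boundedly often.
\<close>

section \<open>Linear algebra in the endomorphism ring\<close>

lemma endo_eqI: "(\<And>f. app a f = app b f) \<Longrightarrow> a = b"
  by (metis app_inject ext)

lemma escale_mult [simp]: "escale c a * b = escale c (a * b)" "a * escale c b = escale c (a * b)"
  by (transfer; simp add: linear_gscale_iff)+

lemma minus_one_power_mult_in_subspace:
  assumes "endo.subspace V" "a \<in> V"
  shows "(- 1) ^ n * a \<in> V"
  by (cases "even n") (use assms in \<open>auto intro: endo.subspace_neg\<close>)

text \<open>Instantiated with both the product and the supercommutator, so that closure of a span
  under either is checked on generators. Linearity is used in one argument at a time.\<close>

lemma span_bilinear:
  assumes "\<And>x y z. h (x + y) z = h x z + h y z" "\<And>x y z. h x (y + z) = h x y + h x z"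
    and "\<And>c x y. h (escale c x) y = escale c (h x y)" "\<And>c x y. h x (escale c y) = escale c (h x y)"
    and V: "endo.subspace V" and XY: "\<And>x y. x \<in> X \<Longrightarrow> y \<in> Y \<Longrightarrow> h x y \<in> V"
    and a: "a \<in> endo.span X" and b: "b \<in> endo.span Y"
  shows "h a b \<in> V"
proof -
  have z: "h 0 y = 0" "h y 0 = 0" for y
    using assms(3)[of 0 0 y] assms(4)[of y 0 0] by simp_all
  have 1: "h x b \<in> V" if x: "x \<in> X" for x
    using b
  proof (induction rule: endo.span_induct_alt)
    case base then show ?case using z V by (simp add: endo.subspace_0)
  next
    case (step c y b)
    then show ?case using assms(2,4) V XY[OF x] by (simp add: endo.subspace_add endo.subspace_scale)
  qed
  show ?thesis
    using a
  proof (induction rule: endo.span_induct_alt)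
    case base then show ?case using z V by (simp add: endo.subspace_0)
  next
    case (step c y b)
    then show ?case using assms(1,3) V 1 by (simp add: endo.subspace_add endo.subspace_scale)
  qed
qed

lemma span_mult:
  assumes "endo.subspace V" "\<And>x y. x \<in> X \<Longrightarrow> y \<in> Y \<Longrightarrow> x * y \<in> V"
    and "a \<in> endo.span X" "b \<in> endo.span Y"
  shows "a * b \<in> V"
  by (rule span_bilinear[where h = "(*)"]) (use assms in \<open>auto simp: algebra_simps\<close>)

lemma ecomp_add: "ecomp d (a + b) = ecomp d a + ecomp d b"
  by (simp add: ecomp_def algebra_simps sum.distrib)

lemma ecomp_scale: "ecomp d (escale c a) = escale c (ecomp d a)"
  by (simp add: ecomp_def endo.scale_sum_right)

lemma span_scomm:
  assumes "endo.subspace V" "\<And>x y. x \<in> X \<Longrightarrow> y \<in> Y \<Longrightarrow> scomm x y \<in> V"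
    and "a \<in> endo.span X" "b \<in> endo.span Y"
  shows "scomm a b \<in> V"
  by (rule span_bilinear[where h = scomm])
    (use assms in \<open>auto simp: scomm_def ecomp_add ecomp_scale algebra_simps sum.distrib sum_subtractf
        endo.scale_sum_right endo.scale_right_diff_distrib\<close>)

lemma span_ecomp:
  fixes a :: "'k::field endo"
  assumes "endo.subspace V" "\<And>x. x \<in> X \<Longrightarrow> ecomp d x \<in> V" and a: "a \<in> endo.span X"
  shows "ecomp d a \<in> V"
  using a
proof (induction rule: endo.span_induct_alt)
  case base
  have "ecomp d (0 :: 'k endo) = 0" by (simp add: ecomp_def)
  then show ?case using assms(1) by (simp add: endo.subspace_0)
next
  case (step c x b)
  then show ?case using assms by (simp add: ecomp_add ecomp_scale endo.subspace_add endo.subspace_scale)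
qed

text \<open>Taking a component fixes the homogeneous generators of the right parity and kills the
  others. In particular an odd element of the span is a combination of odd generators.\<close>

lemma ecomp_in_span:
  assumes X: "\<And>x. x \<in> X \<Longrightarrow> \<exists>d. ehom d x" and a: "a \<in> endo.span X"
  shows "ecomp d a \<in> endo.span {x \<in> X. ehom d x}"
proof (rule span_ecomp[OF endo.subspace_span _ a])
  fix x assume x: "x \<in> X"
  then obtain e where e: "ehom e x" using X by blast
  then have "ehom d x" if "even (e + d)"
    using that ehom_ecomp[of d x] by (simp add: ecomp_ehom)
  then show "ecomp d x \<in> endo.span {x \<in> X. ehom d x}"
    using x by (auto simp: ecomp_ehom[OF e] endo.span_zero intro: endo.span_base)
qed

section \<open>Homogeneous endomorphisms and squares in spans\<close>

lemma subspace_gcomp: "grassmann.subspace (gcomp d)"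
proof (rule grassmann.subspaceI)
  fix f g :: "'a grassmann" and c assume f: "f \<in> gcomp d"
  show "gscale c f \<in> gcomp d" using f by (auto simp: gcomp_def gscale.rep_eq)
  assume g: "g \<in> gcomp d"
  have "gcoeff f S \<noteq> 0 \<or> gcoeff g S \<noteq> 0" if "gcoeff (f + g) S \<noteq> 0" for S
    using that by (auto simp: plus_grassmann.rep_eq)
  then show "f + g \<in> gcomp d" using f g unfolding gcomp_def by blast
qed (simp add: gcomp_def zero_grassmann.rep_eq)

lemma subspace_ehom: "endo.subspace {a. ehom d a}"
  by (rule endo.subspaceI)
    (auto simp: ehom_def zero_endo.rep_eq plus_endo.rep_eq escale.rep_eq
      intro: grassmann.subspace_0 grassmann.subspace_add grassmann.subspace_scale subspace_gcomp)

lemma ehom_mult: "ehom d a \<Longrightarrow> ehom e b \<Longrightarrow> ehom (d + e) (a * b)"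
  unfolding ehom_def times_endo.rep_eq by (metis add.assoc add.commute)

lemma ehom_one: "ehom 0 1"
  by (simp add: ehom_def one_endo.rep_eq)

text \<open>The step is \<open>(c x + y)\<^sup>2 = c\<^sup>2 x\<^sup>2 + c [x, y] + y\<^sup>2\<close> for odd \<open>x\<close> and \<open>y\<close>.\<close>

lemma square_in_subspace:
  assumes V: "endo.subspace V" and X: "\<And>x. x \<in> X \<Longrightarrow> \<exists>d. ehom d x"
    and sq: "\<And>x. x \<in> X \<Longrightarrow> ehom 1 x \<Longrightarrow> x\<^sup>2 \<in> V"
    and sc: "\<And>x y. x \<in> X \<Longrightarrow> y \<in> X \<Longrightarrow> scomm x y \<in> V"
    and a: "a \<in> endo.span X" "ehom 1 a"
  shows "a\<^sup>2 \<in> V"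
proof -
  let ?X = "{x \<in> X. ehom 1 x}"
  have "a \<in> endo.span ?X"
    using ecomp_in_span[OF X a(1), of 1] ecomp_ehom[OF a(2), of 1] by simp
  \<comment> \<open>Span membership is carried through the induction because it makes the partial
    sum odd, so that its supercommutator with \<open>x\<close> is the anticommutator.\<close>
  then have "a\<^sup>2 \<in> V \<and> a \<in> endo.span ?X"
  proof (induction rule: endo.span_induct_alt)
    case base then show ?case using V by (simp add: endo.subspace_0 endo.span_zero)
  next
    case (step c x y)
    have "endo.span ?X \<subseteq> {a. ehom 1 a}"
      by (rule endo.span_minimal[OF _ subspace_ehom]) auto
    then have y: "ehom 1 y" using step by auto
    have x: "x \<in> X" "ehom 1 x" using step by auto
    have "scomm x y \<in> V"
      by (rule span_scomm[OF V sc, of X X])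
        (use x(1) step endo.span_mono[of ?X X] in \<open>auto intro: endo.span_base\<close>)
    moreover have "scomm x y = x * y + y * x"
      using scomm_ehom[OF x(2) y] by simp
    ultimately have "x * y + y * x \<in> V" by simp
    then have "escale (c * c) (x\<^sup>2) + escale c (x * y + y * x) + y\<^sup>2 \<in> V"
      using endo.subspace_add[OF V endo.subspace_add[OF V]] endo.subspace_scale[OF V] sq[OF x] step
      by (simp only:)
    also have "escale (c * c) (x\<^sup>2) + escale c (x * y + y * x) + y\<^sup>2 = (escale c x + y)\<^sup>2"
      by (simp add: power2_eq_square distrib_left distrib_right endo.scale_right_distrib add.assoc)
    finally show ?case
      using step by (intro conjI endo.span_add[OF endo.span_scale[OF endo.span_base]]) auto
  qed
  then show ?thesis by blast
qed

lemma lie_subalgebra_span: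
  assumes X: "\<And>x. x \<in> X \<Longrightarrow> \<exists>d. ehom d x"
    and sq: "\<And>x. CHAR('k) = 2 \<Longrightarrow> x \<in> X \<Longrightarrow> ehom 1 x \<Longrightarrow> x\<^sup>2 \<in> X"
    and sc: "\<And>x y. x \<in> X \<Longrightarrow> y \<in> X \<Longrightarrow> scomm x y \<in> X"
  shows "lie_subalgebra (endo.span X :: 'k::field endo set)"
proof -
  have "ecomp d a \<in> endo.span X" if "a \<in> endo.span X" for a d
    using ecomp_in_span[OF X that, of d] endo.span_mono[of "{x \<in> X. ehom d x}" X] by auto
  moreover have "scomm a b \<in> endo.span X" if "a \<in> endo.span X" "b \<in> endo.span X" for a b
    by (rule span_scomm[OF _ _ that]) (auto intro: endo.span_base sc)
  moreover have "a\<^sup>2 \<in> endo.span X" if "CHAR('k) = 2" "a \<in> endo.span X" "ehom 1 a" for a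
    by (rule square_in_subspace[OF endo.subspace_span X _ _ that(2,3)])
      (simp_all add: endo.span_base sc sq that(1))
  ultimately show ?thesis by (simp add: lie_subalgebra_def)
qed

text \<open>Local nilpotency concerns finitely many arbitrary elements of a span; this replaces them
  by finitely many spanning elements.\<close>

lemma finite_subset_span:
  assumes "finite F" "F \<subseteq> endo.span X"
  obtains Y where "finite Y" "Y \<subseteq> X" "F \<subseteq> endo.span Y"
  using assms
proof (induction F arbitrary: thesis)
  case empty then show ?case by (metis empty_subsetI finite.emptyI)
next
  case (insert f F)
  obtain Y where Y: "finite Y" "Y \<subseteq> X" "F \<subseteq> endo.span Y"
    using insert by auto
  have "f \<in> endo.span X" using insert.prems by simp
  then obtain T r where T: "finite T" "T \<subseteq> X" "f = (\<Sum>a\<in>T. escale (r a) a)"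
    unfolding endo.span_explicit by blast
  have "f \<in> endo.span T"
    unfolding T(3) by (intro endo.span_sum endo.span_scale endo.span_base)
  have "insert f F \<subseteq> endo.span (Y \<union> T)"
    using Y(3) \<open>f \<in> endo.span T\<close> endo.span_mono[of Y "Y \<union> T"] endo.span_mono[of T "Y \<union> T"] by auto
  then show ?case using insert.prems(1)[of "Y \<union> T"] Y T by auto
qed

lemma span_Union_span:
  "endo.span (\<Union>{endo.span (X n m) | n m. P n m}) = endo.span (\<Union>{X n m | n m. P n m})"
proof
  show "endo.span (\<Union>{endo.span (X n m) | n m. P n m}) \<subseteq> endo.span (\<Union>{X n m | n m. P n m})"
    by (rule endo.span_minimal) (auto intro: endo.span_mono[THEN subsetD, rotated])
  show "endo.span (\<Union>{X n m | n m. P n m}) \<subseteq> endo.span (\<Union>{endo.span (X n m) | n m. P n m})"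
    by (rule endo.span_mono) (auto intro: endo.span_base)
qed

section \<open>A nilpotency criterion\<close>

text \<open>Products of at least k elements of \<open>Y\<close> span a decreasing multiplicative
  filtration that vanishes from N on. The k-th powers of both hulls lie in its k-th term, so
  vanishing of associative products settles the Lie case too, squares included.\<close>

lemma nilpotent_hulls:
  fixes Y F :: "'k::field endo set"
  assumes hom: "\<And>a. a \<in> Y \<Longrightarrow> \<exists>d. ehom d a"
    and zero: "\<And>as. set as \<subseteq> Y \<Longrightarrow> length as = N \<Longrightarrow> prod_list as = 0"
    and F: "F \<subseteq> endo.span Y"
  shows "assoc_nilpotent (assoc_subalgebra hull F)" and "lie_nilpotent (lie_subalgebra hull F)"
proof -
  \<comment> \<open>Length at least k, rather than exactly k, makes the terms \<open>B k\<close>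
    decreasing, so that \<open>B 1\<close> is a subalgebra.\<close>
  define G where "G k = {prod_list as | as. set as \<subseteq> Y \<and> k \<le> length as}" for k
  define B where "B k = endo.span (G k)" for k
  have sub: "endo.subspace (B k)" for k by (simp add: B_def)
  have B_mono: "B l \<subseteq> B k" if "k \<le> l" for k l
    unfolding B_def G_def by (rule endo.span_mono) (use that in auto)
  have B_mult: "a * b \<in> B (k + l)" if "a \<in> B k" "b \<in> B l" for a b k l
  proof (rule span_mult[OF sub])
    fix x y assume "x \<in> G k" "y \<in> G l"
    then obtain as bs where "x = prod_list as" "set as \<subseteq> Y" "k \<le> length as"
      "y = prod_list bs" "set bs \<subseteq> Y" "l \<le> length bs" by (auto simp: G_def)
    then have "x * y = prod_list (as @ bs)" "set (as @ bs) \<subseteq> Y" "k + l \<le> length (as @ bs)" by auto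
    then show "x * y \<in> B (k + l)" unfolding B_def G_def by (blast intro: endo.span_base)
  qed (use that in \<open>auto simp: B_def\<close>)
  have homG: "\<exists>d. ehom d x" if "x \<in> G k" for x k
  proof -
    have "\<exists>d. ehom d (prod_list as)" if "set as \<subseteq> Y" for as
      using that
    proof (induction as)
      case Nil then show ?case using ehom_one by auto
    next
      case (Cons a as)
      then obtain d e where "ehom d a" "ehom e (prod_list as)" using hom by force
      then show ?case using ehom_mult[of d a e] by auto
    qed
    then show ?thesis using that by (auto simp: G_def)
  qed
  have B_ecomp: "ecomp d a \<in> B k" if "a \<in> B k" for a d k
  proof -
    have "ecomp d a \<in> endo.span {x \<in> G k. ehom d x}"
      by (rule ecomp_in_span[OF homG that[unfolded B_def]])
    moreover have "endo.span {x \<in> G k. ehom d x} \<subseteq> B k"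
      unfolding B_def by (rule endo.span_mono) auto
    ultimately show ?thesis by blast
  qed
  have B_scomm: "scomm a b \<in> B (k + l)" if "a \<in> B k" "b \<in> B l" for a b k l
  proof -
    have "ecomp d a * ecomp e b \<in> B (k + l)" "ecomp e b * ecomp d a \<in> B (k + l)" for d e
      using B_mult[OF B_ecomp[OF that(1)] B_ecomp[OF that(2)]]
        B_mult[OF B_ecomp[OF that(2)] B_ecomp[OF that(1)]] by (auto simp: add.commute)
    then show ?thesis unfolding scomm_def
      by (intro endo.subspace_sum[OF sub] endo.subspace_diff[OF sub] minus_one_power_mult_in_subspace[OF sub])
  qed
  have B_sq: "a\<^sup>2 \<in> B (2 * k)" if "a \<in> B k" for a k
    using B_mult[OF that that] by (simp add: power2_eq_square mult_2)
  have "prod_list as = 0" if "set as \<subseteq> Y" "N \<le> length as" for as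
  proof -
    have "prod_list as = prod_list (take N as) * prod_list (drop N as)"
      by (metis append_take_drop_id prod_list.append)
    moreover have "prod_list (take N as) = 0"
      by (rule zero) (use that set_take_subset[of N as] in auto)
    ultimately show ?thesis by simp
  qed
  then have "G n \<subseteq> {0}" if "N \<le> n" for n
    using that unfolding G_def by fastforce
  then have B0: "B n \<subseteq> {0}" if "N \<le> n" for n
    using that endo.span_mono[of "G n" "{0}"] by (auto simp: B_def)
  have "Y \<subseteq> G 1"
  proof
    fix a assume "a \<in> Y"
    then show "a \<in> G 1" unfolding G_def by (intro CollectI exI[of _ "[a]"]) auto
  qed
  then have F1: "F \<subseteq> B 1" using F endo.span_mono[of Y "G 1"] by (auto simp: B_def)
  \<comment> \<open>From 2 on, \<open>lie_power\<close> is given by its recursive clause, a span,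
    and so contains 0. The bound also covers the case N = 0.\<close>
  define n where "n = max N 2"
  have "assoc_subalgebra (B 1)"
    unfolding assoc_subalgebra_def
  proof (intro conjI ballI)
    fix a b assume "a \<in> B 1" "b \<in> B 1"
    then show "a * b \<in> B 1" using B_mult[of a 1 b 1] B_mono[of 1 "1 + 1"] by auto
  qed (rule sub)
  then have A: "assoc_subalgebra hull F \<subseteq> B 1" using F1 by (intro hull_minimal)
  have "prod_list as \<in> B (length as)" if "set as \<subseteq> B 1" for as
    using that
  proof (induction as)
    case Nil
    have "1 \<in> G 0" unfolding G_def by (intro CollectI exI[of _ "[]"]) auto
    then show ?case by (auto simp: B_def intro: endo.span_base)
  next
    case (Cons a as)
    then show ?case using B_mult[of a 1 "prod_list as"] by simp
  qed
  then have "{prod_list as | as. length as = n \<and> set as \<subseteq> assoc_subalgebra hull F} \<subseteq> {0}"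
    using A B0[of n] by (force simp: n_def)
  then have "assoc_power (assoc_subalgebra hull F) n = {0}"
    unfolding assoc_power_def using endo.span_mono[of _ "{0}"] endo.span_zero by auto
  then show "assoc_nilpotent (assoc_subalgebra hull F)"
    unfolding assoc_nilpotent_def by (intro exI[of _ n]) (simp add: n_def)
  have "lie_subalgebra (B 1)"
    unfolding lie_subalgebra_def
  proof (intro conjI ballI allI impI)
    fix a b assume "a \<in> B 1" "b \<in> B 1"
    then show "scomm a b \<in> B 1" using B_scomm[of a 1 b 1] B_mono[of 1 "1 + 1"] by auto
  next
    fix a assume "a \<in> B 1"
    then show "a\<^sup>2 \<in> B 1" using B_sq[of a 1] B_mono[of 1 "2 * 1"] by auto
  qed (use sub B_ecomp in auto)
  then have L: "lie_subalgebra hull F \<subseteq> B 1" using F1 by (intro hull_minimal)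
  have LB: "lie_power (lie_subalgebra hull F) k \<subseteq> B k" if "1 \<le> k" for k
    using that
  proof (induction k rule: less_induct)
    case (less k)
    show ?case
    proof (cases "k = 1")
      case True then show ?thesis using L by (simp add: lie_power.simps)
    next
      case False
      then have IH: "lie_power (lie_subalgebra hull F) (k - 1) \<subseteq> B (k - 1)"
        "lie_power (lie_subalgebra hull F) ((k + 1) div 2) \<subseteq> B ((k + 1) div 2)"
        using less by auto
      have "scomm a b \<in> B k" if "a \<in> lie_subalgebra hull F" "b \<in> lie_power (lie_subalgebra hull F) (k - 1)" for a b
        using B_scomm[of a 1 b "k - 1"] that IH L less.prems by auto
      moreover have "a\<^sup>2 \<in> B k" if "a \<in> lie_power (lie_subalgebra hull F) ((k + 1) div 2)" for a
      proof -
        \<comment> \<open>Rounding k / 2 up is what puts the square at depth at least k.\<close>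
        have "k \<le> 2 * ((k + 1) div 2)" by presburger
        then show ?thesis using B_sq that IH(2) B_mono by blast
      qed
      ultimately show ?thesis
        using False less.prems by (subst lie_power.simps, simp) (intro conjI impI endo.span_minimal sub; auto)
    qed
  qed
  have "lie_power (lie_subalgebra hull F) n \<subseteq> {0}"
    using LB[of n] B0[of n] by (force simp: n_def)
  moreover have "0 \<in> lie_power (lie_subalgebra hull F) n"
    by (subst lie_power.simps) (simp add: n_def endo.span_zero)
  ultimately show "lie_nilpotent (lie_subalgebra hull F)"
    unfolding lie_nilpotent_def by (intro exI[of _ n]) (auto simp: n_def)
qed

section \<open>Supports\<close>

text \<open>Only supports are recorded. The implication goes one way, so cancellation is harmless
  and signs need not be tracked.\<close>

definition moves :: "(nat set \<Rightarrow> nat set \<Rightarrow> bool) \<Rightarrow> 'k::field endo \<Rightarrow> bool" where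
  "moves \<rho> a \<longleftrightarrow> (\<forall>f U. gcoeff (app a f) U \<noteq> 0 \<longrightarrow> (\<exists>S. gcoeff f S \<noteq> 0 \<and> \<rho> S U))"

lemma subspace_moves: "endo.subspace {a. moves \<rho> a}"
proof (rule endo.subspaceI; unfold mem_Collect_eq)
  fix a b :: "'a endo" and c assume a: "moves \<rho> a"
  show "moves \<rho> (escale c a)"
    using a unfolding moves_def by (auto simp: escale.rep_eq gscale.rep_eq)
  assume b: "moves \<rho> b"
  have "gcoeff (app a f) U \<noteq> 0 \<or> gcoeff (app b f) U \<noteq> 0" if "gcoeff (app (a + b) f) U \<noteq> 0" for f U
    using that by (auto simp: plus_endo.rep_eq plus_grassmann.rep_eq)
  then show "moves \<rho> (a + b)" using a b unfolding moves_def by blast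
qed (simp add: moves_def zero_endo.rep_eq zero_grassmann.rep_eq)

text \<open>The right factor acts first, hence \<sigma> comes before \<rho>.\<close>

lemma moves_mult:
  assumes "moves \<rho> a" "moves \<sigma> b" "\<And>S T U. \<sigma> S T \<Longrightarrow> \<rho> T U \<Longrightarrow> \<tau> S U"
  shows "moves \<tau> (a * b)"
  using assms unfolding moves_def times_endo.rep_eq by meson

lemma moves_one: "moves (\<lambda>S U. finite S \<and> S = U) 1"
  unfolding moves_def one_endo.rep_eq using gcoeff_infinite by blast

lemma moves_mono: "moves \<rho> a \<Longrightarrow> (\<And>S U. \<rho> S U \<Longrightarrow> \<sigma> S U) \<Longrightarrow> moves \<sigma> a"
  unfolding moves_def by meson

lemma moves_False: "moves (\<lambda>_ _. False) a \<Longrightarrow> a = 0"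
  unfolding moves_def by (auto intro!: endo_eqI grassmann_eqI simp: zero_endo.rep_eq zero_grassmann.rep_eq)

section \<open>Testing moves on basis monomials\<close>

definition gmono :: "nat set \<Rightarrow> 'k::field grassmann" where
  "gmono S = prod_list (map gen (sorted_list_of_set S))"

lemma gcoeff_gmono: "finite S \<Longrightarrow> gcoeff (gmono S) T = (if T = S then 1 else 0)"
  by (simp add: gmono_def gcoeff_prod_gen)

lemma app_expansion:
  assumes "gcoeff (app a f) U \<noteq> 0"
  obtains S where "finite S" "gcoeff f S \<noteq> 0" "gcoeff (app a (gmono S)) U \<noteq> 0"
proof -
  have app_sum: "app a (\<Sum>S\<in>A. h S) = (\<Sum>S\<in>A. app a (h S))" for A :: "nat set set" and h
    by (induction A rule: infinite_finite_induct) simp_all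
  have sum: "gcoeff (\<Sum>S\<in>A. h S) U = (\<Sum>S\<in>A. gcoeff (h S) U)" for A :: "nat set set" and h :: "nat set \<Rightarrow> 'a grassmann"
    by (induction A rule: infinite_finite_induct) (simp_all add: zero_grassmann.rep_eq plus_grassmann.rep_eq)
  have "app a f = (\<Sum>S | gcoeff f S \<noteq> 0. gscale (gcoeff f S) (app a (gmono S)))"
    by (subst grassmann_expansion[of f]) (simp add: app_sum gmono_def)
  then have "(\<Sum>S | gcoeff f S \<noteq> 0. gcoeff f S * gcoeff (app a (gmono S)) U) \<noteq> 0"
    using assms by (simp add: sum gscale.rep_eq)
  then obtain S where "gcoeff f S \<noteq> 0" "gcoeff f S * gcoeff (app a (gmono S)) U \<noteq> 0"
    using sum.not_neutral_contains_not_neutral by (metis (mono_tags, lifting) mem_Collect_eq)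
  then show ?thesis using that gcoeff_infinite by (metis mult_zero_right)
qed

lemma moves_gmonoI:
  assumes "\<And>S U. finite S \<Longrightarrow> gcoeff (app a (gmono S)) U \<noteq> 0 \<Longrightarrow> \<rho> S U"
  shows "moves \<rho> a"
  unfolding moves_def using assms app_expansion by metis

lemma moves_gmonoD:
  assumes "moves \<rho> a" "finite S" "gcoeff (app a (gmono S)) U \<noteq> 0"
  shows "\<rho> S U"
  using assms unfolding moves_def by (metis gcoeff_gmono)

lemma gcoeff_mult_nonzero:
  assumes "gcoeff (f * g) U \<noteq> 0"
  obtains V where "V \<subseteq> U" "gcoeff f V \<noteq> 0" "gcoeff g (U - V) \<noteq> 0"
proof -
  have "(\<Sum>S\<in>Pow U. gsign S (U - S) * gcoeff f S * gcoeff g (U - S)) \<noteq> 0"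
    using assms by (simp add: times_grassmann.rep_eq)
  then obtain V where "V \<in> Pow U" "gsign V (U - V) * gcoeff f V * gcoeff g (U - V) \<noteq> 0"
    by (rule sum.not_neutral_contains_not_neutral)
  then show ?thesis by (intro that[of V]) auto
qed

lemma gcoeff_prod_gen_nonzero:
  "gcoeff (prod_list (map gen is) :: 'k::field grassmann) U \<noteq> 0 \<Longrightarrow> U = set is"
proof (induction "is" arbitrary: U)
  case Nil then show ?case by (auto simp: one_grassmann.rep_eq split: if_splits)
next
  case (Cons i "is")
  from Cons.prems have "gcoeff (gen i * prod_list (map gen is) :: 'k grassmann) U \<noteq> 0" by simp
  then obtain V where V: "V \<subseteq> U" "gcoeff (gen i :: 'k grassmann) V \<noteq> 0"
    "gcoeff (prod_list (map gen is) :: 'k grassmann) (U - V) \<noteq> 0"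
    by (rule gcoeff_mult_nonzero)
  then have "V = {i}" by (simp add: gen.rep_eq split: if_splits)
  then show ?case using V(1) Cons.IH[OF V(3)] by auto
qed

text \<open>This is the effect of the summand x_i ... x_(j-1) d_j of the pivot on a monomial, where
  d_j is the partial superderivative. If a new letter were already present, the product would
  vanish; hence the disjointness.\<close>

definition pivot_move :: "nat \<Rightarrow> nat set \<Rightarrow> nat set \<Rightarrow> bool" where
  "pivot_move i S U \<longleftrightarrow> (\<exists>j R. i \<le> j \<and> even (j - i) \<and> finite R \<and> j \<notin> R \<and> R \<inter> {i..<j} = {} \<and>
    S = insert j R \<and> U = R \<union> {i..<j})"

lemma moves_pivot: "moves (pivot_move i) (pivot i :: 'k::field endo)"
  unfolding moves_def
proof (intro allI impI)
  fix f :: "'k grassmann" and U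
  let ?F = "\<lambda>k. prod_list (map gen [i..<i + 2 * k]) * gpd (i + 2 * k) f"
  assume "gcoeff (app (pivot i) f) U \<noteq> 0"
  then have nz: "gcoeff (\<Sum>k | ?F k \<noteq> 0. ?F k) U \<noteq> 0"
    by (simp add: pivot.rep_eq gpivot_def Sum_any.expand_set)
  have sum: "gcoeff (\<Sum>k\<in>A. h k) U = (\<Sum>k\<in>A. gcoeff (h k) U)" for A :: "nat set" and h :: "nat \<Rightarrow> 'k grassmann"
    by (induction A rule: infinite_finite_induct) (simp_all add: zero_grassmann.rep_eq plus_grassmann.rep_eq)
  obtain k where "gcoeff (?F k) U \<noteq> 0"
    using nz unfolding sum by (rule sum.not_neutral_contains_not_neutral)
  then obtain V where V: "V \<subseteq> U" "gcoeff (prod_list (map gen [i..<i + 2 * k]) :: 'k grassmann) V \<noteq> 0"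
    "gcoeff (gpd (i + 2 * k) f) (U - V) \<noteq> 0"
    by (rule gcoeff_mult_nonzero)
  have Veq: "V = {i..<i + 2 * k}" using gcoeff_prod_gen_nonzero[OF V(2)] by simp
  have R: "i + 2 * k \<notin> U - V" "gcoeff f (insert (i + 2 * k) (U - V)) \<noteq> 0"
    using V(3) by (auto simp: gpd.rep_eq split: if_splits)
  then have "finite (U - V)" using gcoeff_infinite by (metis finite_insert)
  then have "pivot_move i (insert (i + 2 * k) (U - V)) U"
    unfolding pivot_move_def
    by (intro exI[of _ "i + 2 * k"] exI[of _ "U - V"]) (use V(1) Veq R(1) in auto)
  then show "\<exists>S. gcoeff f S \<noteq> 0 \<and> pivot_move i S U" using R(2) by blast
qed

section \<open>Weight and superweight of moves\<close>

lemma pivot_move_sum: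
  fixes g :: "nat \<Rightarrow> int"
  assumes "finite R" "j \<notin> R" "R \<inter> {i..<j} = {}"
  shows "sum g (insert j R) - sum g (R \<union> {i..<j}) = g j - sum g {i..<j}"
  using assms by (simp add: sum.union_disjoint)

definition high :: "nat \<Rightarrow> (nat \<Rightarrow> int) \<Rightarrow> nat \<Rightarrow> int" where
  "high N g s = (if N \<le> s then g s else 0)"

text \<open>The letters have negative weight, so a move of weight \<open>w\<close> lowers the sum of the powers of 2 by \<open>w\<close>.\<close>

definition graded_move :: "nat \<Rightarrow> int \<Rightarrow> int \<Rightarrow> nat set \<Rightarrow> nat set \<Rightarrow> bool" where
  "graded_move N w d S U \<longleftrightarrow> finite S \<and> finite U \<and>
    sum ((^) 2) S - sum ((^) 2) U = w \<and> sum ((^) (- 1)) S - sum ((^) (- 1)) U = d \<and>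
    (\<exists>k::nat. sum (high N ((^) 2)) S - sum (high N ((^) 2)) U = int k * 2 ^ N \<and>
      \<bar>sum (high N ((^) (- 1))) S - sum (high N ((^) (- 1))) U\<bar> \<le> 2 * int k)"

lemma graded_move_trans:
  assumes "graded_move N w d S T" "graded_move N w' d' T U"
  shows "graded_move N (w + w') (d + d') S U"
proof -
  let ?p = "sum (high N ((^) 2))" and ?s = "sum (high N ((^) (- 1)))"
  obtain k k' where "?p S - ?p T = int k * 2 ^ N" "\<bar>?s S - ?s T\<bar> \<le> 2 * int k"
    "?p T - ?p U = int k' * 2 ^ N" "\<bar>?s T - ?s U\<bar> \<le> 2 * int k'"
    using assms unfolding graded_move_def by blast
  then have "?p S - ?p U = int (k + k') * 2 ^ N \<and> \<bar>?s S - ?s U\<bar> \<le> 2 * int (k + k')"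
    by (simp add: distrib_right)
  then have "\<exists>k::nat. ?p S - ?p U = int k * 2 ^ N \<and> \<bar>?s S - ?s U\<bar> \<le> 2 * int k" by blast
  then show ?thesis using assms unfolding graded_move_def by auto
qed

lemma graded_move_refl: "finite S \<Longrightarrow> graded_move N 0 0 S S"
  unfolding graded_move_def by (auto intro!: exI[of _ 0])

lemma sum_power2_int: "i \<le> j \<Longrightarrow> sum ((^) 2) {i..<j} = (2 ^ j - 2 ^ i :: int)"
  by (induction j rule: dec_induct) simp_all

lemma sum_alternating: "i \<le> j \<Longrightarrow> sum ((^) (- 1)) {i..<j} = (if even (j - i) then 0 else (- 1) ^ i :: int)"
  by (induction j rule: dec_induct) (auto simp: minus_one_power_iff)

lemma sum_high:
  assumes "i \<le> N"
  shows "sum (high N g) {i..<j} = sum g {N..<j}"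
proof -
  have "sum (high N g) {i..<j} = sum g ({i..<j} \<inter> {N..})"
    unfolding high_def by (subst sum.inter_restrict) (auto intro: sum.cong)
  also have "{i..<j} \<inter> {N..} = {N..<j}" using assms by auto
  finally show ?thesis .
qed

text \<open>If the move reaches above \<open>N\<close>, then its part above \<open>N\<close> looks like a move of the pivot \<open>v\<^sub>N\<close>
  or of \<open>x\<^sub>N v\<^bsub>N+1\<^esub>\<close>, both of which have weight \<open>2\<^sup>N\<close>.\<close>

lemma graded_move_pivot:
  assumes "pivot_move i S U" "i \<le> N"
  shows "graded_move N (2 ^ i) ((- 1) ^ i) S U"
proof -
  obtain j R where j: "i \<le> j" "even (j - i)" and R: "finite R" "j \<notin> R" "R \<inter> {i..<j} = {}"
    and SU: "S = insert j R" "U = R \<union> {i..<j}"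
    using assms(1) unfolding pivot_move_def by blast
  note diff = pivot_move_sum[OF R]
  have "\<exists>k::nat. sum (high N ((^) 2)) S - sum (high N ((^) 2)) U = int k * 2 ^ N \<and>
      \<bar>sum (high N ((^) (- 1))) S - sum (high N ((^) (- 1))) U\<bar> \<le> 2 * int k"
    unfolding SU diff sum_high[OF assms(2)]
  proof (cases "N \<le> j")
    case True
    then have "\<bar>sum ((^) (- 1)) {N..<j} :: int\<bar> \<le> 1" by (simp add: sum_alternating power_abs)
    moreover have "\<bar>(- 1) ^ j :: int\<bar> = 1" by (simp add: power_abs)
    ultimately have "\<bar>(- 1) ^ j - sum ((^) (- 1)) {N..<j} :: int\<bar> \<le> 2" by linarith
    \<comment> \<open>The witness is 1: the sum of 2^s over N \<le> s < j is 2^j - 2^N. A move that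
      stays below N needs k = 0.\<close>
    then show "\<exists>k::nat. high N ((^) 2) j - sum ((^) 2) {N..<j} = int k * 2 ^ N \<and>
        \<bar>high N ((^) (- 1)) j - sum ((^) (- 1)) {N..<j}\<bar> \<le> 2 * int k"
      using True by (intro exI[of _ 1]) (simp add: high_def sum_power2_int)
  qed (auto simp: high_def intro!: exI[of _ 0])
  moreover have "(- 1) ^ j = ((- 1) ^ i :: int)" using j by (auto simp: minus_one_power_iff)
  then have "sum ((^) (- 1)) S - sum ((^) (- 1)) U = ((- 1) ^ i :: int)"
    using j by (simp add: SU diff sum_alternating)
  moreover have "sum ((^) 2) S - sum ((^) 2) U = (2 ^ i :: int)"
    unfolding SU diff using j by (simp add: sum_power2_int)
  ultimately show ?thesis unfolding graded_move_def SU using R(1) by blast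
qed

text \<open>The letters below N have total weight in [0, 2^N), so k 2^N < 2 * 2^N and k \<le> 1. The
  high letters then change the superweight by at most 2, and the low letters of S and of U account
  for at most N each.\<close>

lemma abs_superweight_bound:
  assumes "graded_move N w d S U" "w \<le> 2 ^ N"
  shows "\<bar>d\<bar> \<le> 2 * int N + 2"
proof -
  define low where "low g X = sum g (X \<inter> {..<N})" for g :: "nat \<Rightarrow> int" and X
  have split: "sum g X = low g X + sum (high N g) X" if "finite X" for g X
  proof -
    have "sum g X = sum g (X \<inter> {..<N}) + sum g (X - {..<N})"
      using that by (rule sum.Int_Diff)
    also have "sum g (X - {..<N}) = sum (high N g) X"
      by (rule sum.mono_neutral_cong_left) (use that in \<open>auto simp: high_def\<close>)
    finally show ?thesis by (simp add: low_def)
  qed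
  have pos: "0 \<le> low ((^) 2) X" for X unfolding low_def by (rule sum_nonneg) simp
  have lt: "low ((^) 2) X < 2 ^ N" for X
  proof -
    have "low ((^) 2) X \<le> sum ((^) 2) {0..<N}" unfolding low_def by (rule sum_mono2) auto
    then show ?thesis by (simp add: sum_power2_int)
  qed
  have sgn: "\<bar>low ((^) (- 1)) X\<bar> \<le> int N" for X
  proof -
    have "\<bar>low ((^) (- 1)) X\<bar> \<le> (\<Sum>s\<in>X \<inter> {..<N}. \<bar>(- 1) ^ s\<bar>)" unfolding low_def by (rule sum_abs)
    also have "\<dots> = int (card (X \<inter> {..<N}))" by (simp add: power_abs)
    also have "card (X \<inter> {..<N}) \<le> card {..<N}" by (rule card_mono) auto
    finally show ?thesis by simp
  qed
  obtain k where k: "sum (high N ((^) 2)) S - sum (high N ((^) 2)) U = int k * 2 ^ N"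
    "\<bar>sum (high N ((^) (- 1))) S - sum (high N ((^) (- 1))) U\<bar> \<le> 2 * int k"
    and fin: "finite S" "finite U"
    and w: "sum ((^) 2) S - sum ((^) 2) U = w" "sum ((^) (- 1)) S - sum ((^) (- 1)) U = d"
    using assms(1) unfolding graded_move_def by blast
  have "int k * 2 ^ N < 2 * 2 ^ N"
    using k(1) w(1) pos[of S] lt[of U] assms(2) split[OF fin(1), of "(^) 2"] split[OF fin(2), of "(^) 2"] by linarith
  then have "k \<le> 1" by simp
  then show ?thesis
    using k(2) w(2) sgn[of S] sgn[of U] split[OF fin(1), of "(^) (- 1)"] split[OF fin(2), of "(^) (- 1)"] by linarith
qed

text \<open>The pivots 0 and 1 have weights 1 and 2 and superweights 1 and -1, which add up along a
  word. The bound on N makes \<open>graded_move_pivot\<close> available for both pivots.\<close>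

lemma A_comp_moves:
  assumes "a \<in> A_comp n m" "1 \<le> N"
  shows "moves (graded_move N (int n + 2 * int m) (int n - int m)) a"
proof -
  have word: "moves (graded_move N (int (count_list w 0) + 2 * int (count_list w 1))
      (int (count_list w 0) - int (count_list w 1))) (prod_list (map pivot w) :: 'a endo)"
    if "set w \<subseteq> {0, 1}" for w
    using that
  proof (induction w)
    case Nil
    show ?case by (simp, rule moves_mono[OF moves_one]) (auto intro: graded_move_refl)
  next
    case (Cons i w)
    have i: "i = 0 \<or> i = 1" using Cons.prems by auto
    have p: "moves (graded_move N (2 ^ i) ((- 1) ^ i)) (pivot i :: 'a endo)"
      by (rule moves_mono[OF moves_pivot]) (use i assms(2) in \<open>auto intro!: graded_move_pivot\<close>)
    have eq: "int (count_list w 0) + 2 * int (count_list w 1) + 2 ^ i =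
        int (count_list (i # w) 0) + 2 * int (count_list (i # w) 1)"
      "int (count_list w 0) - int (count_list w 1) + (- 1) ^ i =
        int (count_list (i # w) 0) - int (count_list (i # w) 1)"
      using i by auto
    have "moves (graded_move N (int (count_list w 0) + 2 * int (count_list w 1) + 2 ^ i)
        (int (count_list w 0) - int (count_list w 1) + (- 1) ^ i)) (pivot i * prod_list (map pivot w) :: 'a endo)"
      by (rule moves_mult[OF p Cons.IH]) (use Cons.prems in \<open>auto intro: graded_move_trans\<close>)
    then show ?case unfolding eq by simp
  qed
  have "A_comp n m \<subseteq> {a :: 'a endo. moves (graded_move N (int n + 2 * int m) (int n - int m)) a}"
    unfolding A_comp_def by (rule endo.span_minimal[OF _ subspace_moves]) (use word in blast)
  then show ?thesis using assms(1) by blast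
qed

section \<open>The triangular decompositions\<close>

text \<open>The predicate on multidegrees allows one treatment of the three components, the whole
  algebra and a single multidegree.\<close>

definition A_words :: "(nat \<Rightarrow> nat \<Rightarrow> bool) \<Rightarrow> 'k::field endo set" where
  "A_words P = {prod_list (map pivot w) | w. w \<noteq> [] \<and> set w \<subseteq> {0, 1} \<and> P (count_list w 0) (count_list w 1)}"

definition R_monomials :: "(nat \<Rightarrow> nat \<Rightarrow> bool) \<Rightarrow> 'k::field endo set" where
  "R_monomials P = {a. \<exists>n m. P n m \<and> lie_monomial n m a}"

lemma A_span: "endo.span (\<Union>{A_comp n m | n m. P n m}) = endo.span (A_words P)"
proof -
  have "\<Union>{{prod_list (map pivot w) | w. w \<noteq> [] \<and> set w \<subseteq> {0, 1} \<and> count_list w 0 = n \<and> count_list w 1 = m} | n m. P n m}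
      = (A_words P :: 'a endo set)" unfolding A_words_def by blast
  then show ?thesis unfolding A_comp_def span_Union_span by simp
qed

lemma R_span: "endo.span (\<Union>{R_comp n m | n m. P n m}) = endo.span (R_monomials P)"
proof -
  have "\<Union>{{a. lie_monomial n m a} | n m. P n m} = (R_monomials P :: 'a endo set)"
    unfolding R_monomials_def by blast
  then show ?thesis unfolding R_comp_def span_Union_span by simp
qed

lemma A_words_comp:
  assumes "a \<in> A_words P"
  obtains n m where "P n m" "a \<in> A_comp n m"
  using assms unfolding A_words_def A_comp_def by (blast intro: endo.span_base)

lemma A_words_mult:
  fixes a b :: "'k::field endo"
  assumes "a \<in> A_words P" "b \<in> A_words Q" "\<And>n m n' m'. P n m \<Longrightarrow> Q n' m' \<Longrightarrow> T (n + n') (m + m')"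
  shows "a * b \<in> A_words T"
proof -
  obtain v w where "a = prod_list (map pivot v)" "v \<noteq> []" "set v \<subseteq> {0, 1}" "P (count_list v 0) (count_list v 1)"
    "b = prod_list (map pivot w)" "set w \<subseteq> {0, 1}" "Q (count_list w 0) (count_list w 1)"
    using assms(1,2) unfolding A_words_def by blast
  then show ?thesis
    unfolding A_words_def using assms(3) by (intro CollectI exI[of _ "v @ w"]) auto
qed

lemma A_comp_eq: "A_comp n m = endo.span (A_words (\<lambda>n' m'. n' = n \<and> m' = m))"
  unfolding A_comp_def A_words_def ..

lemma A_comp_mult:
  fixes a b :: "'k::field endo"
  assumes "a \<in> A_comp n m" "b \<in> A_comp n' m'"
  shows "a * b \<in> A_comp (n + n') (m + m')"
  using assms unfolding A_comp_eq
  by (rule span_mult[rotated 2]) (auto intro!: endo.span_base elim: A_words_mult)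

text \<open>Each move trades one letter for an even number of letters, so it flips the
  parity.\<close>

lemma ehom_pivot: "ehom 1 (pivot i :: 'k::field endo)"
  unfolding ehom_def gcomp_def
proof (intro allI ballI CollectI impI)
  fix c and f :: "'k grassmann" and U
  assume f: "f \<in> {f. \<forall>S. gcoeff f S \<noteq> 0 \<longrightarrow> even (card S + c)}" and "gcoeff (app (pivot i) f) U \<noteq> 0"
  then obtain S where S: "gcoeff f S \<noteq> 0" "pivot_move i S U"
    using moves_pivot[of i] unfolding moves_def by blast
  then obtain j R where "i \<le> j" "even (j - i)" "finite R" "j \<notin> R" "R \<inter> {i..<j} = {}"
    "S = insert j R" "U = R \<union> {i..<j}" unfolding pivot_move_def by blast
  then have "card U = card R + (j - i)" "card S = card R + 1" "even (j - i)" by (simp_all add: card_Un_disjoint)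
  then show "even (card U + (c + 1))" using f S(1) by auto
qed

lemma ehom_A_comp:
  assumes "a \<in> A_comp n m"
  shows "ehom (n + m) a"
proof -
  have word: "ehom (length w) (prod_list (map pivot w) :: 'a endo)" for w
  proof (induction w)
    case (Cons i w)
    then show ?case using ehom_mult[OF ehom_pivot[of i] Cons] by simp
  qed (simp add: ehom_one)
  have len: "length w = count_list w 0 + count_list w 1" if "set w \<subseteq> {0, 1}" for w :: "nat list"
    using that by (induction w) auto
  have "A_comp n m \<subseteq> {a :: 'a endo. ehom (n + m) a}"
    unfolding A_comp_def by (rule endo.span_minimal[OF _ subspace_ehom]) (use word len in \<open>auto; metis\<close>)
  then show ?thesis using assms by blast
qed

text \<open>Brackets and squares expand into words of the same multidegree, so whatever is known
  about the supports of words carries over to Lie monomials.\<close>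

lemma lie_monomial_A_comp: "lie_monomial n m a \<Longrightarrow> a \<in> A_comp n m"
proof (induction rule: lie_monomial.induct)
  case 1
  show ?case unfolding A_comp_def
    by (intro endo.span_base CollectI exI[of _ "[0]"]) auto
next
  case 2
  show ?case unfolding A_comp_def
    by (intro endo.span_base CollectI exI[of _ "[1]"]) auto
next
  case (3 n m a n' m' b)
  have sub: "endo.subspace (A_comp (n + n') (m + m'))" by (simp add: A_comp_def)
  have "b * a \<in> A_comp (n + n') (m + m')" using A_comp_mult[OF 3(4,3)] by (simp add: add.commute)
  then show ?case
    unfolding scomm_ehom[OF ehom_A_comp[OF 3(3)] ehom_A_comp[OF 3(4)]]
    by (intro endo.subspace_diff[OF sub] A_comp_mult[OF 3(3,4)] minus_one_power_mult_in_subspace[OF sub])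
next
  case (4 n m a)
  show ?case using A_comp_mult[OF 4(4,4)] by (simp add: power2_eq_square mult_2)
qed

lemma R_monomials_ehom: "a \<in> R_monomials P \<Longrightarrow> \<exists>d. ehom d a"
  unfolding R_monomials_def using lie_monomial_A_comp ehom_A_comp by blast

lemma R_monomials_subset_span: "endo.span (R_monomials P) \<subseteq> endo.span (A_words P)"
proof (rule endo.span_minimal[OF _ endo.subspace_span], rule subsetI)
  fix a :: "'a endo" assume "a \<in> R_monomials P"
  then obtain n m where "P n m" "a \<in> A_comp n m"
    unfolding R_monomials_def using lie_monomial_A_comp by blast
  moreover from this have "A_comp n m \<subseteq> endo.span (A_words P :: 'a endo set)"
    unfolding A_comp_eq by (intro endo.span_mono) (auto simp: A_words_def)
  ultimately show "a \<in> endo.span (A_words P)" by blast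
qed

section \<open>Subalgebras from sums of multidegrees, and the generated algebras\<close>

lemma assoc_subalgebra_A:
  assumes "\<And>n m n' m'. P n m \<Longrightarrow> P n' m' \<Longrightarrow> P (n + n') (m + m')"
  shows "assoc_subalgebra (endo.span (A_words P))"
  unfolding assoc_subalgebra_def
proof (intro conjI ballI endo.subspace_span)
  fix a b :: "'a endo" assume "a \<in> endo.span (A_words P)" "b \<in> endo.span (A_words P)"
  then show "a * b \<in> endo.span (A_words P)"
    by (rule span_mult[rotated 2]) (auto intro!: endo.span_base intro: A_words_mult assms)
qed

lemma lie_subalgebra_R:
  assumes P: "\<And>n m n' m'. P n m \<Longrightarrow> P n' m' \<Longrightarrow> P (n + n') (m + m')"
  shows "lie_subalgebra (endo.span (R_monomials P))"
proof (rule lie_subalgebra_span[OF R_monomials_ehom])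
  fix x :: "'a endo" assume "CHAR('a) = 2" "x \<in> R_monomials P" "ehom 1 x"
  then show "x\<^sup>2 \<in> R_monomials P"
    unfolding R_monomials_def using lie_monomial.intros(4)[of _ _ x] P by (fastforce simp: mult_2)
next
  fix x y :: "'a endo" assume "x \<in> R_monomials P" "y \<in> R_monomials P"
  then show "scomm x y \<in> R_monomials P"
    unfolding R_monomials_def using lie_monomial.intros(3) P by blast
qed auto

lemma assoc_A_eq: "assoc_A = endo.span (A_words (\<lambda>_ _. True))"
proof
  have "prod_list (map pivot [i]) \<in> A_words (\<lambda>_ _. True)" if "i = 0 \<or> i = 1" for i
    using that unfolding A_words_def by (intro CollectI exI[of _ "[i]"]) auto
  then show "assoc_A \<subseteq> (endo.span (A_words (\<lambda>_ _. True)) :: 'a endo set)"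
    unfolding assoc_A_def
    by (intro hull_minimal assoc_subalgebra_A) (auto intro!: endo.span_base dest: spec[of _ 0] spec[of _ 1])
  show "endo.span (A_words (\<lambda>_ _. True)) \<subseteq> (assoc_A :: 'a endo set)"
    unfolding assoc_A_def hull_def
  proof (rule Inter_greatest)
    fix T :: "'a endo set" assume "T \<in> {t. assoc_subalgebra t \<and> {pivot 0, pivot 1} \<subseteq> t}"
    then have T: "endo.subspace T" "\<And>a b. a \<in> T \<Longrightarrow> b \<in> T \<Longrightarrow> a * b \<in> T" "pivot 0 \<in> T" "pivot 1 \<in> T"
      by (auto simp: assoc_subalgebra_def)
    have "prod_list (map pivot w) \<in> T" if "w \<noteq> []" "set w \<subseteq> {0, 1}" for w
      using that
    \<comment> \<open>There is no unit to start from, so the induction begins with words of one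
      letter.\<close>
    proof (induction w rule: list_nonempty_induct)
      case (single i) then show ?case using T by auto
    next
      case (cons i w) then show ?case using T by auto
    qed
    then show "endo.span (A_words (\<lambda>_ _. True)) \<subseteq> T"
      by (intro endo.span_minimal[OF _ T(1)]) (auto simp: A_words_def)
  qed
qed

lemma lie_R_eq: "lie_R = endo.span (R_monomials (\<lambda>_ _. True))"
proof
  show "lie_R \<subseteq> (endo.span (R_monomials (\<lambda>_ _. True)) :: 'a endo set)"
    unfolding lie_R_def
  proof (intro hull_minimal lie_subalgebra_R)
    have "pivot 0 \<in> (R_monomials (\<lambda>_ _. True) :: 'a endo set)" "pivot 1 \<in> (R_monomials (\<lambda>_ _. True) :: 'a endo set)"
      unfolding R_monomials_def using lie_monomial.intros(1,2) by blast+
    then show "{pivot 0, pivot 1} \<subseteq> (endo.span (R_monomials (\<lambda>_ _. True)) :: 'a endo set)"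
      by (auto intro: endo.span_base)
  qed simp
  show "endo.span (R_monomials (\<lambda>_ _. True)) \<subseteq> (lie_R :: 'a endo set)"
    unfolding lie_R_def hull_def
  proof (rule Inter_greatest)
    fix T :: "'a endo set" assume "T \<in> {t. lie_subalgebra t \<and> {pivot 0, pivot 1} \<subseteq> t}"
    then have T: "lie_subalgebra T" "pivot 0 \<in> T" "pivot 1 \<in> T" by auto
    have "a \<in> T" if "lie_monomial n m a" for n m a
      using that by induction (use T in \<open>auto simp: lie_subalgebra_def\<close>)
    then show "endo.span (R_monomials (\<lambda>_ _. True)) \<subseteq> T"
      using T(1) by (intro endo.span_minimal) (auto simp: R_monomials_def lie_subalgebra_def)
  qed
qed

text \<open>A given pair S, U has one superweight difference, and its sign lets at most one of the
  three summands have a nonzero coefficient there. Allowing subsets of the spans makes the result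
  apply to the Lie components as well.\<close>

lemma direct_sum3_A_words:
  assumes "X \<subseteq> endo.span (A_words (>))" "Y \<subseteq> endo.span (A_words (=))" "Z \<subseteq> endo.span (A_words (<))"
    and "V = {x + y + z | x y z. x \<in> X \<and> y \<in> Y \<and> z \<in> Z}"
  shows "direct_sum3 V X Y Z"
proof -
  let ?d = "\<lambda>S U. sum ((^) (- 1)) S - sum ((^) (- 1)) U :: int"
  have mv: "moves (\<lambda>S U. Q (?d S U)) a"
    if "a \<in> endo.span (A_words P)" "\<And>n m. P n m \<Longrightarrow> Q (int n - int m)" for P Q and a :: "'a endo"
  proof -
    have "A_words P \<subseteq> {a :: 'a endo. moves (\<lambda>S U. Q (?d S U)) a}"
      by (auto elim!: A_words_comp dest!: A_comp_moves[where N = 1] that(2) elim!: moves_mono simp: graded_move_def)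
    then have "endo.span (A_words P) \<subseteq> {a :: 'a endo. moves (\<lambda>S U. Q (?d S U)) a}"
      by (rule endo.span_minimal[OF _ subspace_moves])
    then show ?thesis using that(1) by blast
  qed
  have "x = 0 \<and> y = 0 \<and> z = 0" if "x \<in> X" "y \<in> Y" "z \<in> Z" "x + y + z = 0" for x y z
  proof -
    have m: "moves (\<lambda>S U. ?d S U > 0) x" "moves (\<lambda>S U. ?d S U = 0) y" "moves (\<lambda>S U. ?d S U < 0) z"
      by (rule mv[of _ "(>)"] mv[of _ "(=)"] mv[of _ "(<)"]; use that assms(1-3) in auto)+
    have "gcoeff (app x f) U + gcoeff (app y f) U + gcoeff (app z f) U = gcoeff (app (x + y + z) f) U" for f U
      by (simp add: plus_endo.rep_eq plus_grassmann.rep_eq)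
    then have s: "gcoeff (app x f) U + gcoeff (app y f) U + gcoeff (app z f) U = 0" for f U
      by (simp add: that(4) zero_endo.rep_eq zero_grassmann.rep_eq)
    have "gcoeff (app x (gmono S)) U = 0 \<and> gcoeff (app y (gmono S)) U = 0 \<and> gcoeff (app z (gmono S)) U = 0"
      if "finite S" for S U
    proof -
      have "gcoeff (app x (gmono S)) U = 0 \<or> ?d S U > 0" "gcoeff (app y (gmono S)) U = 0 \<or> ?d S U = 0"
        "gcoeff (app z (gmono S)) U = 0 \<or> ?d S U < 0"
        using moves_gmonoD[OF m(1) that] moves_gmonoD[OF m(2) that] moves_gmonoD[OF m(3) that] by blast+
      then show ?thesis using s[of "gmono S" U] by auto
    qed
    then show ?thesis by (auto intro!: moves_False moves_gmonoI)
  qed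
  then show ?thesis unfolding direct_sum3_def using assms(4) by blast
qed

lemma span_Un3:
  "endo.span (X \<union> Y \<union> Z) = {x + y + z | x y z. x \<in> endo.span X \<and> y \<in> endo.span Y \<and> z \<in> endo.span Z}"
  unfolding endo.span_Un by blast

section \<open>Superderivations\<close>

definition superderivation :: "nat \<Rightarrow> 'k::field endo \<Rightarrow> bool" where
  "superderivation d D \<longleftrightarrow> ehom d D \<and>
    (\<forall>c. \<forall>f\<in>gcomp c. \<forall>g. app D (f * g) = app D f * g + (- 1) ^ (c * d) * (f * app D g))"

lemma gen_supercommute:
  assumes "f \<in> gcomp c"
  shows "gen i * f = (- 1) ^ c * (f * (gen i :: 'k::field grassmann))"
proof (rule grassmann_eqI)
  fix U
  show "gcoeff (gen i * f) U = gcoeff ((- 1) ^ c * (f * gen i)) U"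
  proof (cases "finite U")
    case True
    have "gcoeff (gen i * f) U =
        (\<Sum>S\<in>Pow U. if S = {i} then gsign {i} (U - {i}) * gcoeff f (U - {i}) else 0)"
      unfolding times_grassmann.rep_eq by (rule sum.cong) (auto simp: gen.rep_eq)
    also have "\<dots> = (if i \<in> U then gsign {i} (U - {i}) * gcoeff f (U - {i}) else 0)"
      using True by (simp add: sum.delta)
    finally have 1: "gcoeff (gen i * f) U = \<dots>" .
    have "gcoeff (f * gen i) U =
        (\<Sum>S\<in>Pow U. if S = U - {i} then if i \<in> U then gsign (U - {i}) {i} * gcoeff f (U - {i}) else 0 else 0)"
      unfolding times_grassmann.rep_eq
    proof (rule sum.cong[OF refl])
      fix S assume S: "S \<in> Pow U"
      then have "U - S = {i} \<longleftrightarrow> S = U - {i} \<and> i \<in> U" by auto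
      moreover have "U - (U - {i}) = {i}" if "i \<in> U" using that by auto
      ultimately show "gsign S (U - S) * gcoeff f S * gcoeff (gen i) (U - S) =
          (if S = U - {i} then if i \<in> U then gsign (U - {i}) {i} * gcoeff f (U - {i}) else 0 else 0)"
        by (auto simp: gen.rep_eq)
    qed
    also have "\<dots> = (if i \<in> U then gsign (U - {i}) {i} * gcoeff f (U - {i}) else 0)"
      using True by (simp add: sum.delta)
    finally have 2: "gcoeff (f * gen i) U = \<dots>" .
    let ?R = "U - {i}"
    have "gsign {i} ?R = (- 1) ^ card {t \<in> ?R. t < i}" "gsign ?R {i} = (- 1) ^ card ?R * (- 1 :: 'k) ^ card {t \<in> ?R. t < i}"
      using gsign_insert_left[of "{}" ?R i] gsign_insert_right[of ?R "{}" i] True by simp_all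
    moreover have "gcoeff f ?R = 0 \<or> (- 1) ^ c = ((- 1) ^ card ?R :: 'k)"
      using assms by (auto simp: gcomp_def minus_one_power_iff)
    ultimately show ?thesis
      unfolding minus_one_power_gmult gscale.rep_eq 1 2 by (auto simp: minus_one_power_iff)
  qed (simp add: gcoeff_infinite)
qed

text \<open>The coefficients of a pivot are products of evenly many letters; moving them past f
  costs no sign, so the pivot inherits the Leibniz rule of the partial superderivatives.\<close>

lemma even_gens_commute:
  assumes "f \<in> gcomp c" "even (length is)"
  shows "prod_list (map gen is) * f = f * (prod_list (map gen is) :: 'k::field grassmann)"
proof -
  have "prod_list (map gen is) * f = (- 1) ^ (c * length is) * (f * (prod_list (map gen is) :: 'k grassmann))" for "is"
  proof (induction "is")
    case (Cons i "is")
    have comm: "(- 1) ^ n * g = g * ((- 1) ^ n :: 'k grassmann)" for n and g :: "'k grassmann"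
      by (cases "even n") simp_all
    have "prod_list (map gen (i # is)) * f = gen i * ((- 1) ^ (c * length is) * (f * prod_list (map gen is)))"
      by (simp add: mult.assoc Cons)
    also have "\<dots> = (- 1) ^ (c * length is) * (gen i * f * prod_list (map gen is))"
      by (metis comm mult.assoc)
    also have "\<dots> = (- 1) ^ (c * length (i # is)) * (f * prod_list (map gen (i # is)))"
      by (simp add: gen_supercommute[OF assms(1)] power_add mult.assoc) (metis comm mult.assoc)
    finally show ?case .
  qed simp
  then show ?thesis using assms(2) by simp
qed

lemma superderivation_pivot: "superderivation 1 (pivot i :: 'k::field endo)"
  unfolding superderivation_def
proof (intro conjI allI ballI ehom_pivot)
  fix c and f g :: "'k grassmann" assume f: "f \<in> gcomp c"
  let ?p = "\<lambda>k. prod_list (map gen [i..<i + 2 * k]) :: 'k grassmann"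
  let ?F = "\<lambda>f k. ?p k * gpd (i + 2 * k) f"
  have split: "?F (f * g) k = ?F f k * g + (- 1) ^ c * f * ?F g k" for k
  proof -
    have "?p k * ((- 1) ^ c * (f * gpd (i + 2 * k) g)) = (- 1) ^ c * (?p k * f * gpd (i + 2 * k) g)"
      by (cases "even c") (simp_all add: mult.assoc)
    also have "?p k * f = f * ?p k" by (rule even_gens_commute[OF f]) simp
    finally show ?thesis by (simp add: gpd_mult[OF f] distrib_left mult.assoc)
  qed
  have fin: "finite {k. ?F f k * g \<noteq> 0}" "finite {k. (- 1) ^ c * f * ?F g k \<noteq> 0}"
    by (rule finite_subset[OF _ finite_gpivot[of i f]] finite_subset[OF _ finite_gpivot[of i g]]; force)+
  show "app (pivot i) (f * g) = app (pivot i) f * g + (- 1) ^ (c * 1) * (f * app (pivot i) g)"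
    unfolding pivot.rep_eq gpivot_def split Sum_any.distrib[OF fin]
      Sum_any_left_distrib[OF finite_gpivot, symmetric] Sum_any_right_distrib[OF finite_gpivot, symmetric]
    by (simp add: mult.assoc)
qed

text \<open>The mixed terms \<open>app D f * app E g\<close> and \<open>app E f * app D g\<close>
  cancel by the choice of sign in \<open>scomm\<close>.\<close>

lemma superderivation_scomm:
  assumes D: "superderivation d D" and E: "superderivation e E"
  shows "superderivation (d + e) (scomm D E)"
proof -
  have hom: "ehom d D" "ehom e E" using assms by (auto simp: superderivation_def)
  have LD: "app D (f * g) = app D f * g + (- 1) ^ (c * d) * (f * app D g)" if "f \<in> gcomp c" for c f g
    using D that unfolding superderivation_def by blast
  have LE: "app E (f * g) = app E f * g + (- 1) ^ (c * e) * (f * app E g)" if "f \<in> gcomp c" for c f g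
    using E that unfolding superderivation_def by blast
  have sgn: "app a ((- 1) ^ n * f) = (- 1) ^ n * app a f" for a :: "'a endo" and n f
    by (simp add: minus_one_power_gmult)
  have eq: "scomm D E = D * E - (- 1) ^ (d * e) * (E * D)" by (rule scomm_ehom[OF hom])
  have app_sc: "app (scomm D E) f = app D (app E f) - (- 1) ^ (d * e) * app E (app D f)" for f
  proof -
    have "app ((- 1) ^ n) h = (- 1) ^ n * h" for n and h :: "'a grassmann"
      by (cases "even n") (simp_all add: uminus_endo.rep_eq one_endo.rep_eq)
    then show ?thesis by (simp only: eq minus_endo.rep_eq times_endo.rep_eq)
  qed
  have "ehom (d + e) (scomm D E)"
  proof -
    have "D * E - (- 1) ^ (d * e) * (E * D) \<in> {a. ehom (d + e) a}"
      by (intro endo.subspace_diff[OF subspace_ehom] minus_one_power_mult_in_subspace[OF subspace_ehom])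
        (use ehom_mult[OF hom] ehom_mult[OF hom(2,1)] in \<open>simp_all add: add.commute\<close>)
    then show ?thesis by (simp add: eq)
  qed
  moreover have "app (scomm D E) (f * g) = app (scomm D E) f * g + (- 1) ^ (c * (d + e)) * (f * app (scomm D E) g)"
    if f: "f \<in> gcomp c" for c f g
  proof -
    have "app D f \<in> gcomp (c + d)" "app E f \<in> gcomp (c + e)" using hom f by (auto simp: ehom_def)
    note L = LD[OF f] LE[OF f] LE[OF this(1)] LD[OF this(2)]
    show ?thesis
      unfolding app_sc L app_add sgn
      by (cases "even c"; cases "even d"; cases "even e") (simp_all add: algebra_simps)
  qed
  ultimately show ?thesis unfolding superderivation_def by blast
qed

text \<open>For odd d the two mixed terms \<open>app D f * app D g\<close> have opposite signs. No
  division by 2 occurs, so this covers characteristic 2.\<close>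

lemma superderivation_square:
  assumes D: "superderivation d D" and d: "odd d"
  shows "superderivation (2 * d) (D\<^sup>2)"
proof -
  have hom: "ehom d D" using assms by (auto simp: superderivation_def)
  have L: "app D (f * g) = app D f * g + (- 1) ^ (c * d) * (f * app D g)" if "f \<in> gcomp c" for c f g
    using D that unfolding superderivation_def by blast
  have sgn: "app D ((- 1) ^ n * f) = (- 1) ^ n * app D f" for n f
    by (simp add: minus_one_power_gmult)
  have "app (D\<^sup>2) (f * g) = app (D\<^sup>2) f * g + (- 1) ^ (c * (2 * d)) * (f * app (D\<^sup>2) g)"
    if f: "f \<in> gcomp c" for c f g
  proof -
    have "app D f \<in> gcomp (c + d)" using hom f by (auto simp: ehom_def)
    note L' = L[OF f] L[OF this]
    show ?thesis
      unfolding power2_eq_square times_endo.rep_eq L' app_add sgn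
      using d by (cases "even c") (simp_all add: algebra_simps)
  qed
  moreover have "ehom (2 * d) (D\<^sup>2)" using ehom_mult[OF hom hom] by (simp add: power2_eq_square mult_2)
  ultimately show ?thesis unfolding superderivation_def by blast
qed

lemma superderivation_lie_monomial: "lie_monomial n m a \<Longrightarrow> superderivation (n + m) a"
proof (induction rule: lie_monomial.induct)
  case (3 n m a n' m' b)
  have "n + n' + (m + m') = n + m + (n' + m')" by simp
  then show ?case using superderivation_scomm[OF 3(3,4)] by metis
next
  case (4 n m a)
  show ?case
  proof (cases "odd (n + m)")
    case True
    then show ?thesis using superderivation_square[OF 4(4)] by (simp add: distrib_left)
  next
    \<comment> \<open>An element that is both odd and homogeneous of an even degree is 0.\<close>
    case False
    have "ehom (n + m) a" using 4(4) by (simp add: superderivation_def)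
    then have "a = 0"
      using ecomp_ehom[OF 4(3), of 1] ecomp_ehom[of "n + m" a 1] False by simp
    then show ?thesis
      by (simp add: superderivation_def ehom_def gcomp_def zero_endo.rep_eq zero_grassmann.rep_eq)
  qed
qed (use superderivation_pivot[of 0] superderivation_pivot[of 1] in simp_all)

text \<open>Iterating the Leibniz rule, a superderivation replaces one letter at a time, whatever
  its degree. This locality is what distinguishes Lie monomials from general words in the
  superweight zero case.\<close>

lemma superderivation_support:
  fixes D :: "'k::field endo"
  assumes D: "superderivation d D" and "distinct is"
    and "gcoeff (app D (prod_list (map gen is))) U \<noteq> 0"
  shows "\<exists>s\<in>set is. \<exists>T. gcoeff (app D (gen s)) T \<noteq> 0 \<and> U = T \<union> (set is - {s}) \<and> T \<inter> (set is - {s}) = {}"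
  using assms(2,3)
proof (induction "is" arbitrary: U)
  case Nil
  have "(1 :: 'k grassmann) \<in> gcomp 0" by (auto simp: gcomp_def one_grassmann.rep_eq split: if_splits)
  \<comment> \<open>The Leibniz rule for 1 = 1 * 1 gives D 1 = D 1 + D 1, hence D 1 = 0.\<close>
  then have "app D (1 * 1) = app D 1 * 1 + (- 1) ^ (0 * d) * (1 * app D 1)"
    using D unfolding superderivation_def by blast
  then have "app D 1 = 0" by simp
  then show ?case using Nil by (simp add: zero_grassmann.rep_eq)
next
  case (Cons i "is")
  let ?p = "prod_list (map gen is) :: 'k grassmann"
  have "app D (gen i * ?p) = app D (gen i) * ?p + (- 1) ^ (1 * d) * (gen i * app D ?p)"
    using D gen_in_gcomp unfolding superderivation_def by blast
  then have "gcoeff (app D (gen i) * ?p) U \<noteq> 0 \<or> gcoeff (gen i * app D ?p) U \<noteq> 0"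
    using Cons.prems(2) by (auto simp: minus_one_power_gmult plus_grassmann.rep_eq gscale.rep_eq)
  then consider "gcoeff (app D (gen i) * ?p) U \<noteq> 0" | "gcoeff (gen i * app D ?p) U \<noteq> 0"
    by blast
  then show ?case
  proof cases
    case 1
    then obtain V where V: "V \<subseteq> U" "gcoeff (app D (gen i)) V \<noteq> 0" "gcoeff ?p (U - V) \<noteq> 0"
      by (rule gcoeff_mult_nonzero)
    then have "U - V = set is" using gcoeff_prod_gen_nonzero by blast
    then have "U = V \<union> (set (i # is) - {i})" "V \<inter> (set (i # is) - {i}) = {}" using V(1) Cons.prems(1) by auto
    then show ?thesis using V(2) by (intro bexI[of _ i] exI[of _ V]) auto
  next
    case 2
    then obtain V where V: "V \<subseteq> U" "gcoeff (gen i :: 'k grassmann) V \<noteq> 0" "gcoeff (app D ?p) (U - V) \<noteq> 0"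
      by (rule gcoeff_mult_nonzero)
    have Vi: "V = {i}" using V(2) by (simp add: gen.rep_eq split: if_splits)
    obtain s T where s: "s \<in> set is" "gcoeff (app D (gen s)) T \<noteq> 0"
      "U - V = T \<union> (set is - {s})" "T \<inter> (set is - {s}) = {}"
      using Cons.IH[OF _ V(3)] Cons.prems(1) by auto
    have "s \<noteq> i" using s(1) Cons.prems(1) by auto
    then have "U = T \<union> (set (i # is) - {s})" "T \<inter> (set (i # is) - {s}) = {}"
      using s(3,4) V(1) Vi by auto
    then show ?thesis using s(1,2) by auto
  qed
qed

section \<open>The component of superweight zero\<close>

text \<open>Ordered lexicographically: first by the number of letters below \<open>N\<close>, then by decreasing weight of these letters.\<close>

definition potential :: "nat \<Rightarrow> nat set \<Rightarrow> int" where
  "potential N S = int (card (S \<inter> {..<N})) * 2 ^ N + (2 ^ N - 1 - sum ((^) 2) (S \<inter> {..<N}))"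

text \<open>Keeps the second summand of \<open>potential\<close> between 0 and 2^N - 1, so that the
  letter count dominates.\<close>

lemma low_weight_bounds: "0 \<le> (sum ((^) 2) (S \<inter> {..<N}) :: int)" "sum ((^) 2) (S \<inter> {..<N}) < (2 ^ N :: int)"
proof -
  show "0 \<le> (sum ((^) 2) (S \<inter> {..<N}) :: int)" by (rule sum_nonneg) simp
  have "sum ((^) 2) (S \<inter> {..<N}) \<le> (sum ((^) 2) {0..<N} :: int)" by (rule sum_mono2) auto
  then show "sum ((^) 2) (S \<inter> {..<N}) < (2 ^ N :: int)" by (simp add: sum_power2_int)
qed

lemma potential_bounds: "0 \<le> potential N S" "potential N S < (int N + 1) * 2 ^ N"
proof -
  note low = low_weight_bounds[of S N]
  show "0 \<le> potential N S" unfolding potential_def using low by simp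
  have "card (S \<inter> {..<N}) \<le> card {..<N}" by (rule card_mono) auto
  then have "int (card (S \<inter> {..<N})) * 2 ^ N \<le> int N * 2 ^ N" by (intro mult_right_mono) auto
  then show "potential N S < (int N + 1) * 2 ^ N"
    unfolding potential_def distrib_right using low by linarith
qed

lemma lie_monomial_positive: "lie_monomial n m a \<Longrightarrow> 0 < n + m"
  by (induction rule: lie_monomial.induct) auto

lemma not_three_dvd_power2: "\<not> (3::int) dvd 2 ^ s"
proof -
  have "(2::int) ^ s mod 3 = 1 \<or> (2::int) ^ s mod 3 = 2"
    by (induction s) (simp, simp, presburger)
  then show ?thesis by presburger
qed

text \<open>
  Let \<open>x\<^sub>T\<close> occur in \<open>a x\<^sub>s\<close>.  Then \<open>T\<close> has weight \<open>2\<^sup>s - 3 n\<close>.  Since \<open>2\<^sup>s\<close> is not a multiple of 3, \<open>T\<close> is nonempty,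
  and since \<open>0 < 3 n < 2\<^sup>N\<close>, it contains a letter below \<open>N\<close> if \<open>s \<ge> N\<close>.
\<close>

lemma lie_monomial_potential:
  fixes a :: "'k::field endo"
  assumes a: "lie_monomial n n a" and N: "3 * int n < 2 ^ N"
  shows "moves (\<lambda>S U. potential N S < potential N U) a"
proof (rule moves_gmonoI)
  fix S U assume S: "finite S" "gcoeff (app a (gmono S)) U \<noteq> 0"
  then obtain s T where s: "s \<in> S" "gcoeff (app a (gen s)) T \<noteq> 0" "U = T \<union> (S - {s})" "T \<inter> (S - {s}) = {}"
    using superderivation_support[OF superderivation_lie_monomial[OF a], of "sorted_list_of_set S" U]
    unfolding gmono_def by auto
  have n: "0 < n" using lie_monomial_positive[OF a] by simp
  have "1 \<le> N" using n N by (cases N) auto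
  then have "moves (graded_move N (3 * int n) 0) a"
    using A_comp_moves[OF lie_monomial_A_comp[OF a]] by simp
  then obtain S' where "gcoeff (gen s :: 'k grassmann) S' \<noteq> 0" "graded_move N (3 * int n) 0 S' T"
    using s(2) unfolding moves_def by blast
  then have "graded_move N (3 * int n) 0 {s} T" by (simp add: gen.rep_eq split: if_splits)
  then have T: "finite T" "2 ^ s - sum ((^) 2) T = 3 * int n" by (auto simp: graded_move_def)
  \<comment> \<open>Since the weight 3 n is positive, every new letter lies below the replaced one;
    for s < N all of T is therefore low.\<close>
  have Tlt: "t < s" if "t \<in> T" for t
  proof -
    have "(2::int) ^ t \<le> sum ((^) 2) T" by (rule member_le_sum) (use T that in auto)
    then have "(2::int) ^ t < 2 ^ s" using T(2) n by linarith
    then show ?thesis by simp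
  qed
  let ?L = "\<lambda>X. X \<inter> {..<N}" and ?w = "\<lambda>X. sum ((^) 2) (X \<inter> {..<N}) :: int"
  let ?R = "S - {s}"
  have U: "card (?L U) = card (?L T) + card (?L ?R)" "?w U = ?w T + ?w ?R"
  proof -
    have "?L U = ?L T \<union> ?L ?R" "?L T \<inter> ?L ?R = {}" using s(3,4) by auto
    then show "card (?L U) = card (?L T) + card (?L ?R)" "?w U = ?w T + ?w ?R"
      by (simp_all add: card_Un_disjoint sum.union_disjoint)
  qed
  have more: "potential N S < potential N U" if "card (?L S) < card (?L U)"
  proof -
    have "(int (card (?L S)) + 1) * 2 ^ N \<le> int (card (?L U)) * 2 ^ N"
      using that by (intro mult_right_mono) auto
    then show ?thesis
      unfolding potential_def distrib_right using low_weight_bounds[of S N] low_weight_bounds[of U N] by linarith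
  qed
  show "potential N S < potential N U"
  proof (cases "s < N")
    case False
    then have "?L S = ?L ?R" by auto
    moreover have "?L T \<noteq> {}"
    proof
      assume "?L T = {}"
      \<comment> \<open>If all letters of T were at least N, then 2^N would divide both the sum over
        T and 2^s, hence also their difference 3 n, which lies strictly between 0 and 2^N.\<close>
      then have "(2::int) ^ N dvd 2 ^ t" if "t \<in> T" for t
        using that by (auto intro!: le_imp_power_dvd simp: not_less[symmetric])
      then have "2 ^ N dvd sum ((^) (2::int)) T" by (rule dvd_sum)
      moreover have "(2::int) ^ N dvd 2 ^ s" using False by (simp add: le_imp_power_dvd)
      ultimately have "2 ^ N dvd 3 * int n" using T(2) by (metis dvd_diff)
      then show False using N n zdvd_imp_le[of "2 ^ N" "3 * int n"] by simp
    qed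
    then have "0 < card (?L T)" by (simp add: card_gt_0_iff)
    ultimately show ?thesis using more U(1) by simp
  next
    case True
    have LS: "?L S = insert s (?L ?R)" using True s(1) by auto
    have cS: "card (?L S) = card (?L ?R) + 1" "?w S = ?w ?R + 2 ^ s"
      unfolding LS by simp_all
    have LT: "?L T = T" using True Tlt by fastforce
    have "T \<noteq> {}"
    proof
      assume "T = {}"
      then have "(3::int) dvd 2 ^ s" using T(2) by simp
      then show False using not_three_dvd_power2 by blast
    qed
    then have "card T \<ge> 1" using T(1) by (simp add: Suc_le_eq card_gt_0_iff)
    then consider "card T > 1" | "card T = 1" by linarith
    then show ?thesis
    proof cases
      case 1
      then show ?thesis using more U(1) cS(1) LT by simp
    next
      case 2
      then have "card (?L U) = card (?L S)" using U(1) cS(1) LT by simp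
      \<comment> \<open>With one low letter replaced by another the count stays the same, while the
        sum of powers of 2 drops by 3 n.\<close>
      moreover have "?w U < ?w S" using U(2) cS(2) LT T(2) n by simp
      ultimately show ?thesis unfolding potential_def by simp
    qed
  qed
qed

text \<open>Every factor raises the potential by at least 1, and its values lie in [0, (N + 1) 2^N).
  So any product of (N + 1) 2^N of the chosen Lie monomials vanishes.\<close>

lemma R_zero_nilpotent:
  fixes F :: "'k::field endo set"
  assumes "finite F" "F \<subseteq> endo.span (R_monomials (=))"
  shows "lie_nilpotent (lie_subalgebra hull F)"
proof -
  obtain Y where Y: "finite Y" "Y \<subseteq> R_monomials (=)" "F \<subseteq> endo.span Y"
    using assms by (rule finite_subset_span)
  have "\<exists>n. lie_monomial n n a" if "a \<in> Y" for a using Y(2) that unfolding R_monomials_def by blast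
  then obtain n where n: "\<And>a. a \<in> Y \<Longrightarrow> lie_monomial (n a) (n a) a" by metis
  \<comment> \<open>One N for all of \<open>Y\<close>: each \<open>3 * n a\<close> is below N and
    hence below 2^N.\<close>
  define N where "N = Suc (\<Sum>a\<in>Y. 3 * n a)"
  have bound: "3 * int (n a) < 2 ^ N" if "a \<in> Y" for a
  proof -
    have "3 * n a \<le> (\<Sum>a\<in>Y. 3 * n a)" using member_le_sum[OF that, of "\<lambda>a. 3 * n a"] Y(1) by simp
    then have "3 * n a < N" by (simp add: N_def)
    also have "N < 2 ^ N" by simp
    finally have "int (3 * n a) < int (2 ^ N)" by (simp only: of_nat_less_iff)
    then show ?thesis by simp
  qed
  have mv: "moves (\<lambda>S U. potential N S + int (length as) \<le> potential N U) (prod_list as)" if "set as \<subseteq> Y" for as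
    using that
  proof (induction as)
    case Nil
    show ?case by (simp, rule moves_mono[OF moves_one]) auto
  next
    case (Cons a as)
    have "moves (\<lambda>S U. potential N S < potential N U) a"
      using Cons.prems by (intro lie_monomial_potential[OF n bound]) auto
    then have "moves (\<lambda>S U. potential N S + int (length (a # as)) \<le> potential N U) (a * prod_list as)"
      by (rule moves_mult[OF _ Cons.IH]) (use Cons.prems in auto)
    then show ?case by simp
  qed
  show ?thesis
  proof (rule nilpotent_hulls(2)[OF _ _ Y(3)])
    fix a assume "a \<in> Y"
    then show "\<exists>d. ehom d a" using Y(2) R_monomials_ehom by blast
  next
    fix as assume as: "set as \<subseteq> Y" "length as = (N + 1) * 2 ^ N"
    show "prod_list as = 0"
    proof (rule moves_False, rule moves_mono[OF mv[OF as(1)]])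
      fix S U assume "potential N S + int (length as) \<le> potential N U"
      moreover have "int (length as) = (int N + 1) * 2 ^ N" unfolding as(2) by (simp add: algebra_simps)
      ultimately show False using potential_bounds(1)[of N S] potential_bounds(2)[of N U] by linarith
    qed
  qed
qed

section \<open>The components of nonzero superweight\<close>

text \<open>Guarantees that a product of 2 N + 3 factors of weight at most C still has weight at
  most 2^N. The witness 2 M works because both C and 4 M + 3 are at most 2^M.\<close>

lemma linear_le_power2: "\<exists>N\<ge>1. C * (2 * N + 3) \<le> (2::nat) ^ N"
proof -
  obtain M where M: "M = C + 5" by simp
  have "4 * (c + 5) + 3 \<le> (2::nat) ^ (c + 5)" for c by (induction c) (auto simp: power_add)
  then have "2 * (2 * M) + 3 \<le> 2 ^ M" by (simp add: M)
  moreover have "C \<le> 2 ^ M" using less_exp[of M] M by linarith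
  ultimately have "C * (2 * (2 * M) + 3) \<le> 2 ^ M * 2 ^ M" by (intro mult_mono) auto
  also have "(2::nat) ^ M * 2 ^ M = 2 ^ (2 * M)" by (metis mult_2 power_add)
  finally show ?thesis using M by (intro exI[of _ "2 * M"]) simp
qed

text \<open>The sign \<open>\<epsilon>\<close> treats the two signs of the superweight together: in a product of \<open>l\<close> factors the superweight
  grows at least like \<open>l\<close>, whereas a nonzero element of weight at most \<open>2\<^sup>N\<close> has superweight at most \<open>2 N + 2\<close>.\<close>

lemma A_nilpotent:
  fixes F :: "'k::field endo set" and \<epsilon> :: int
  assumes "finite F" "F \<subseteq> endo.span (A_words P)"
    and P: "\<And>n m. P n m \<Longrightarrow> 1 \<le> \<epsilon> * (int n - int m)" and \<epsilon>: "\<bar>\<epsilon>\<bar> = 1"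
  shows "assoc_nilpotent (assoc_subalgebra hull F)" "lie_nilpotent (lie_subalgebra hull F)"
proof -
  obtain Y where Y: "finite Y" "Y \<subseteq> A_words P" "F \<subseteq> endo.span Y"
    using assms(1,2) by (rule finite_subset_span)
  have "\<exists>n m. P n m \<and> a \<in> A_comp n m" if "a \<in> Y" for a using Y(2) that A_words_comp by blast
  then obtain n m where nm: "\<And>a. a \<in> Y \<Longrightarrow> P (n a) (m a)" "\<And>a. a \<in> Y \<Longrightarrow> a \<in> A_comp (n a) (m a)" by metis
  define C where "C = (\<Sum>a\<in>Y. n a + 2 * m a)"
  have C: "n a + 2 * m a \<le> C" if "a \<in> Y" for a
    unfolding C_def using member_le_sum[OF that, of "\<lambda>a. n a + 2 * m a"] Y(1) by simp
  obtain N where N: "1 \<le> N" "C * (2 * N + 3) \<le> 2 ^ N" using linear_le_power2 by blast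
  have mv: "\<exists>w d. moves (graded_move N w d) (prod_list as) \<and> w \<le> int (C * length as) \<and> int (length as) \<le> \<epsilon> * d"
    if "set as \<subseteq> Y" for as
    using that
  proof (induction as)
    case Nil
    have "moves (graded_move N 0 0) (1 :: 'k endo)"
      by (rule moves_mono[OF moves_one]) (auto intro: graded_move_refl)
    then show ?case by (intro exI[of _ 0]) simp
  next
    case (Cons a as)
    then obtain w d where wd: "moves (graded_move N w d) (prod_list as)" "w \<le> int (C * length as)" "int (length as) \<le> \<epsilon> * d"
      by auto
    have a: "a \<in> Y" using Cons.prems by simp
    let ?w = "int (n a) + 2 * int (m a)" and ?d = "int (n a) - int (m a)"
    have "moves (graded_move N (w + ?w) (d + ?d)) (a * prod_list as)"
      by (rule moves_mult[OF A_comp_moves[OF nm(2)[OF a] N(1)] wd(1)]) (rule graded_move_trans)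
    moreover have "w + ?w \<le> int (C * length (a # as))" using wd(2) C[OF a] by simp
    moreover have "int (length (a # as)) \<le> \<epsilon> * (d + ?d)" using wd(3) P[OF nm(1)[OF a]] by (simp add: distrib_left)
    ultimately show ?case by auto
  qed
  have hom: "\<exists>d. ehom d a" if "a \<in> Y" for a using nm(2)[OF that] ehom_A_comp by blast
  \<comment> \<open>The length 2 N + 3 exceeds by one the superweight bound 2 N + 2 of
    \<open>abs_superweight_bound\<close>.\<close>
  have zero: "prod_list as = 0" if as: "set as \<subseteq> Y" "length as = 2 * N + 3" for as
  proof -
    obtain w d where wd: "moves (graded_move N w d) (prod_list as)" "w \<le> int (C * length as)" "int (length as) \<le> \<epsilon> * d"
      using mv[OF as(1)] by blast
    have "w \<le> 2 ^ N" using wd(2) N(2) as(2) by (metis of_nat_le_iff of_nat_numeral of_nat_power order_trans)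
    moreover have "\<epsilon> * d \<le> \<bar>d\<bar>" using \<epsilon> by (metis abs_ge_self abs_mult mult_1)
    ultimately show ?thesis
      using wd(3) as(2) by (intro moves_False moves_mono[OF wd(1)]) (force dest: abs_superweight_bound)
  qed
  show "assoc_nilpotent (assoc_subalgebra hull F)" by (rule nilpotent_hulls(1)[OF hom zero Y(3)])
  show "lie_nilpotent (lie_subalgebra hull F)" by (rule nilpotent_hulls(2)[OF hom zero Y(3)])
qed

lemma A_words_Un: "A_words P \<union> A_words Q = A_words (\<lambda>n m. P n m \<or> Q n m)"
  unfolding A_words_def by blast

lemma R_monomials_Un: "R_monomials P \<union> R_monomials Q = R_monomials (\<lambda>n m. P n m \<or> Q n m)"
  unfolding R_monomials_def by blast

text \<open>The bracketing matches the left-nested union in \<open>span_Un3\<close>, so rewriting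
  splits the full span into the three components.\<close>

lemma trichotomy: "(\<lambda>n m :: nat. True) = (\<lambda>n m. (n > m \<or> n = m) \<or> n < m)"
  by (intro ext) auto

theorem theorem12p3:
  shows "(assoc_subalgebra (A_plus :: 'k::field endo set) \<and> assoc_subalgebra (A_zero :: 'k endo set) \<and>
      assoc_subalgebra (A_minus :: 'k endo set) \<and>
      direct_sum3 (assoc_A :: 'k endo set) A_plus A_zero A_minus) \<and>
    (lie_subalgebra (R_plus :: 'k endo set) \<and> lie_subalgebra (R_zero :: 'k endo set) \<and>
      lie_subalgebra (R_minus :: 'k endo set) \<and>
      direct_sum3 (lie_R :: 'k endo set) R_plus R_zero R_minus) \<and>
    (assoc_locally_nilpotent (A_plus :: 'k endo set) \<and>
      assoc_locally_nilpotent (A_minus :: 'k endo set)) \<and>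
    (lie_locally_nilpotent (R_plus :: 'k endo set) \<and>
      lie_locally_nilpotent (R_zero :: 'k endo set) \<and>
      lie_locally_nilpotent (R_minus :: 'k endo set))"
proof -
  have A: "A_plus = (endo.span (A_words (>)) :: 'k endo set)" "A_zero = (endo.span (A_words (=)) :: 'k endo set)"
    "A_minus = (endo.span (A_words (<)) :: 'k endo set)"
    by (simp_all only: A_plus_def A_zero_def A_minus_def A_span)
  have R: "R_plus = (endo.span (R_monomials (>)) :: 'k endo set)" "R_zero = (endo.span (R_monomials (=)) :: 'k endo set)"
    "R_minus = (endo.span (R_monomials (<)) :: 'k endo set)"
    by (simp_all only: R_plus_def R_zero_def R_minus_def R_span)
  have "direct_sum3 (assoc_A :: 'k endo set) A_plus A_zero A_minus"
    unfolding A by (rule direct_sum3_A_words) (simp_all only: order_refl assoc_A_eq trichotomy span_Un3 flip: A_words_Un)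
  moreover have "direct_sum3 (lie_R :: 'k endo set) R_plus R_zero R_minus"
    unfolding R
    by (rule direct_sum3_A_words) (simp_all only: R_monomials_subset_span lie_R_eq trichotomy span_Un3 flip: R_monomials_Un)
  moreover have "assoc_locally_nilpotent (A_plus :: 'k endo set)" "assoc_locally_nilpotent (A_minus :: 'k endo set)"
    unfolding assoc_locally_nilpotent_def A
    using A_nilpotent(1)[of _ "(>)" 1] A_nilpotent(1)[of _ "(<)" "- 1"] by auto
  \<comment> \<open>Lie monomials lie in the span of words of the same superweight sign, so the
    estimate for words applies, with \<epsilon> = 1 or -1.\<close>
  moreover have "lie_locally_nilpotent (R_plus :: 'k endo set)" "lie_locally_nilpotent (R_minus :: 'k endo set)"
    unfolding lie_locally_nilpotent_def R
    using A_nilpotent(2)[of _ "(>)" 1, OF _ order_trans[OF _ R_monomials_subset_span]]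
      A_nilpotent(2)[of _ "(<)" "- 1", OF _ order_trans[OF _ R_monomials_subset_span]] by auto
  moreover have "lie_locally_nilpotent (R_zero :: 'k endo set)"
    unfolding lie_locally_nilpotent_def R using R_zero_nilpotent by blast
  moreover have "assoc_subalgebra (A_plus :: 'k endo set)" "assoc_subalgebra (A_zero :: 'k endo set)"
    "assoc_subalgebra (A_minus :: 'k endo set)"
    unfolding A by (rule assoc_subalgebra_A; simp)+
  moreover have "lie_subalgebra (R_plus :: 'k endo set)" "lie_subalgebra (R_zero :: 'k endo set)"
    "lie_subalgebra (R_minus :: 'k endo set)"
    unfolding R by (rule lie_subalgebra_R; simp)+
  ultimately show ?thesis by blast
qed

end
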